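(* Let $(X,d,\mu)$ be a quasi-metric-measure space and $\nu$ a finite measure (on the same $\sigma$-algebra as $\mu$) such that $\nu\le C\mu$ for some constant $C\in(0,\infty)$. Then for any $\alpha,p\in(0,\infty)$, $q,r\in(0,\infty]$, $\beta\in(0,\alpha)$ and $\tilde p\in(0,p)$, the embeddings $$M^\alpha_{p,q}(X,d,\mu)\hookrightarrow M^\beta_{\tilde p,r}(X,d,\nu),\qquad M^\alpha_{p,q}(X,d,\mu)\hookrightarrow N^\beta_{\tilde p,r}(X,d,\nu),$$ $$N^\alpha_{p,q}(X,d,\mu)\hookrightarrow M^\beta_{\tilde p,r}(X,d,\nu),\qquad N^\alpha_{p,q}(X,d,\mu)\hookrightarrow N^\beta_{\tilde p,r}(X,d,\nu)$$ are compact. In particular, if $\mu(X)<\infty$, then these four embeddings with $\nu=\mu$ are compact. On the other hand, for any quasi-metric-measure space $(X,d,\mu)$, if any one of the four embeddings above with $\nu=\mu$ is continuous for some $p,\beta\in(0,\infty)$, $\tilde p\in(0,p)$, $q,r\in(0,\infty]$, and $\alpha\in(0,\infty)$ with $\alpha\preceq_q\mathrm{ind}(X,d)$, then $\mu(X)<\infty$.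
   Context: A quasi-metric space $(X,d)$ is a set $X$ with at least two elements and a function $d:X\times X\to[0,\infty)$ for which there are constants $C_0,C_1\in(0,\infty)$ such that for all $x,y,z\in X$: $d(x,y)=0$ iff $x=y$; $d(y,x)\le C_0 d(x,y)$; $d(x,y)\le C_1\max\{d(x,z),d(z,y)\}$ (symmetry is not required). For a quasi-metric $\rho$, $C_\rho:=\sup\frac{\rho(x,y)}{\max\{\rho(x,z),\rho(z,y)\}}\in[1,\infty)$, the supremum over all $x,y,z\in X$ not all equal. Balls are $B_d(x,r):=\{y\in X:d(x,y)<r\}$. The topology $\tau_d$ consists of all $\mathcal O\subseteq X$ such that for each $x\in\mathcal O$ there is $r>0$ with $B_d(x,r)\subseteq\mathcal O$. A quasi-metric-measure space $(X,d,\mu)$ is a quasi-metric space with a nonnegative measure $\mu$ on a $\sigma$-algebra containing the Borel sets of $\tau_d$, such that all $d$-balls are measurable and $\mu(B_d(x,r))\in(0,\infty)$ for all $x\in X$, $r\in(0,\infty)$. Quasi-metrics $d,\rho$ are equivalent ($\rho\approx d$) if $\kappa^{-1}\rho\le d\le\kappa\rho$ on $X\times X$ for some constant $\kappa>0$. $\mathrm{ind}(X,d):=\sup_{\rho\approx d}(\log_2C_\rho)^{-1}\in(0,\infty]$ (with $1/0:=\infty$). The notation $\alpha\preceq_q\mathrm{ind}(X,d)$ means $\alpha\le\mathrm{ind}(X,d)$, where $\alpha=\mathrm{ind}(X,d)$ is permitted only when $q=\infty$ and the supremum defining $\mathrm{ind}(X,d)$ is attained. For a nonnegative Borel measure $m$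 on $(X,d)$ (here $m=\mu$ or $\nu$), $\alpha\in(0,\infty)$ and measurable $u:X\to\mathbb R$, $\mathbb D^\alpha_{d,m}(u)$ is the set of sequences $\vec g=\{g_k\}_{k\in\mathbb Z}$ of nonnegative measurable functions on $X$ for which there is a measurable $E$ with $m(E)=0$ and $|u(x)-u(y)|\le[d(x,y)]^\alpha(g_k(x)+g_k(y))$ for all $k\in\mathbb Z$ and $x,y\in X\setminus E$ with $2^{-k-1}\le d(x,y)<2^{-k}$. The Hajłasz–Triebel–Lizorkin space $M^\alpha_{p,q}(X,d,m)$ is the set of $u\in L^p(X,m)$ with finite (quasi-)norm $\|u\|_{L^p(X,m)}+\inf_{\vec g\in\mathbb D^\alpha_{d,m}(u)}\big\|\,\|\{g_k\}_k\|_{\ell^q(\mathbb Z)}\big\|_{L^p(X,m)}$; the Hajłasz–Besov space $N^\alpha_{p,q}(X,d,m)$ is the set of $u\in L^p(X,m)$ with finite (quasi-)norm $\|u\|_{L^p(X,m)}+\inf_{\vec g\in\mathbb D^\alpha_{d,m}(u)}\big\|\{\|g_k\|_{L^p(X,m)}\}_k\big\|_{\ell^q(\mathbb Z)}$. An embedding is continuous if the natural map (identity on functions) is well defined and bounded for the (quasi-)norms; it is compact if it moreover maps bounded sets to totally bounded sets. *)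

theory Defs
  imports "HOL-Analysis.Analysis"
begin

section \<open>Quasi-metrics\<close>

text \<open>
  A quasi-metric space is a carrier set \<open>X\<close> together with a function \<open>d\<close> on the ambient type;
  only the values of \<open>d\<close> on \<open>X \<times> X\<close> matter.
\<close>

definition quasi_metric :: "'a set \<Rightarrow> ('a \<Rightarrow> 'a \<Rightarrow> real) \<Rightarrow> bool" where
  "quasi_metric X d \<longleftrightarrow>
     (\<exists>x\<in>X. \<exists>y\<in>X. x \<noteq> y) \<and>
     (\<forall>x\<in>X. \<forall>y\<in>X. 0 \<le> d x y) \<and>
     (\<forall>x\<in>X. \<forall>y\<in>X. d x y = 0 \<longleftrightarrow> x = y) \<and>
     (\<exists>C0>0. \<forall>x\<in>X. \<forall>y\<in>X. d y x \<le> C0 * d x y) \<and>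
     (\<exists>C1>0. \<forall>x\<in>X. \<forall>y\<in>X. \<forall>z\<in>X. d x y \<le> C1 * max (d x z) (d z y))"

definition qball :: "'a set \<Rightarrow> ('a \<Rightarrow> 'a \<Rightarrow> real) \<Rightarrow> 'a \<Rightarrow> real \<Rightarrow> 'a set" where
  "qball X d x r = {y \<in> X. d x y < r}"

definition qopens :: "'a set \<Rightarrow> ('a \<Rightarrow> 'a \<Rightarrow> real) \<Rightarrow> 'a set set" where
  "qopens X d = {U. U \<subseteq> X \<and> (\<forall>x\<in>U. \<exists>r>0. qball X d x r \<subseteq> U)}"

definition quasi_metric_measure_space :: "'a measure \<Rightarrow> ('a \<Rightarrow> 'a \<Rightarrow> real) \<Rightarrow> bool" where
  "quasi_metric_measure_space M d \<longleftrightarrow>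
     quasi_metric (space M) d \<and>
     sigma_sets (space M) (qopens (space M) d) \<subseteq> sets M \<and>
     (\<forall>x\<in>space M. \<forall>r>0. qball (space M) d x r \<in> sets M \<and>
        0 < emeasure M (qball (space M) d x r) \<and> emeasure M (qball (space M) d x r) < \<infinity>)"

definition qm_equivalent :: "'a set \<Rightarrow> ('a \<Rightarrow> 'a \<Rightarrow> real) \<Rightarrow> ('a \<Rightarrow> 'a \<Rightarrow> real) \<Rightarrow> bool" where
  "qm_equivalent X \<rho> d \<longleftrightarrow>
     (\<exists>\<kappa>>0. \<forall>x\<in>X. \<forall>y\<in>X. inverse \<kappa> * \<rho> x y \<le> d x y \<and> d x y \<le> \<kappa> * \<rho> x y)"

text \<open>
  For a quasi-metric the set below is nonempty and bounded above, so the real supremum is the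
  genuine one.
\<close>

definition qm_const :: "'a set \<Rightarrow> ('a \<Rightarrow> 'a \<Rightarrow> real) \<Rightarrow> real" where
  "qm_const X \<rho> =
     Sup {\<rho> x y / max (\<rho> x z) (\<rho> z y) |x y z.
            x \<in> X \<and> y \<in> X \<and> z \<in> X \<and> \<not> (x = y \<and> y = z)}"

text \<open>In \<^typ>\<open>ennreal\<close> we have \<open>inverse 0 = \<infinity>\<close>, the convention needed when \<open>qm_const X \<rho> = 1\<close>.\<close>

definition qm_exponent :: "'a set \<Rightarrow> ('a \<Rightarrow> 'a \<Rightarrow> real) \<Rightarrow> ennreal" where
  "qm_exponent X \<rho> = inverse (ennreal (log 2 (qm_const X \<rho>)))"

definition qm_index :: "'a set \<Rightarrow> ('a \<Rightarrow> 'a \<Rightarrow> real) \<Rightarrow> ennreal" where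
  "qm_index X d = (SUP \<rho>\<in>{\<rho>. quasi_metric X \<rho> \<and> qm_equivalent X \<rho> d}. qm_exponent X \<rho>)"

definition qm_index_attained :: "'a set \<Rightarrow> ('a \<Rightarrow> 'a \<Rightarrow> real) \<Rightarrow> bool" where
  "qm_index_attained X d \<longleftrightarrow>
     (\<exists>\<rho>. quasi_metric X \<rho> \<and> qm_equivalent X \<rho> d \<and> qm_exponent X \<rho> = qm_index X d)"

definition below_index :: "real \<Rightarrow> ennreal \<Rightarrow> 'a set \<Rightarrow> ('a \<Rightarrow> 'a \<Rightarrow> real) \<Rightarrow> bool" where
  "below_index \<alpha> q X d \<longleftrightarrow>
     ennreal \<alpha> \<le> qm_index X d \<and>
     (ennreal \<alpha> = qm_index X d \<longrightarrow> q = \<infinity> \<and> qm_index_attained X d)"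

section \<open>Lebesgue and sequence quasi-norms\<close>

text \<open>The power \<open>x\<^sup>p\<close> on \<open>[0,\<infinity>]\<close>, for real exponents \<open>p > 0\<close>.\<close>

definition epowr :: "ennreal \<Rightarrow> real \<Rightarrow> ennreal" where
  "epowr x p = (if x = \<infinity> then \<infinity> else ennreal (enn2real x powr p))"

definition Lp_norm :: "'a measure \<Rightarrow> real \<Rightarrow> ('a \<Rightarrow> ennreal) \<Rightarrow> ennreal" where
  "Lp_norm m p f = epowr (\<integral>\<^sup>+ x. epowr (f x) p \<partial>m) (1 / p)"

definition lq_norm :: "ennreal \<Rightarrow> (int \<Rightarrow> ennreal) \<Rightarrow> ennreal" where
  "lq_norm q a =
     (if q = \<infinity> then (SUP k. a k)
      else epowr (\<integral>\<^sup>+ k. epowr (a k) (enn2real q) \<partial>count_space UNIV) (1 / enn2real q))"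

definition Lp_fun_norm :: "'a measure \<Rightarrow> real \<Rightarrow> ('a \<Rightarrow> real) \<Rightarrow> ennreal" where
  "Lp_fun_norm m p u = Lp_norm m p (\<lambda>x. ennreal \<bar>u x\<bar>)"

section \<open>Hajlasz--Triebel--Lizorkin and Hajlasz--Besov spaces\<close>

text \<open>
  The nonnegative functions \<open>g\<^sub>k\<close> take values in \<open>[0,\<infinity>]\<close>. A sequence for which one of the
  quasi-norms below is finite is finite almost everywhere, so restricting to finite-valued
  functions would not change the infima.
\<close>

definition hajlasz_grads ::
    "('a \<Rightarrow> 'a \<Rightarrow> real) \<Rightarrow> 'a measure \<Rightarrow> real \<Rightarrow> ('a \<Rightarrow> real) \<Rightarrow> (int \<Rightarrow> 'a \<Rightarrow> ennreal) set" where
  "hajlasz_grads d m \<alpha> u =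
     {g. (\<forall>k. g k \<in> borel_measurable m) \<and>
         (\<exists>E\<in>null_sets m. \<forall>k. \<forall>x\<in>space m - E. \<forall>y\<in>space m - E.
            2 powi (- k - 1) \<le> d x y \<and> d x y < 2 powi (- k) \<longrightarrow>
            ennreal \<bar>u x - u y\<bar> \<le> ennreal (d x y powr \<alpha>) * (g k x + g k y))}"

text \<open>
  A function space consists of functions identified when they agree almost everywhere for the
  underlying measure; it is represented by the set of all representatives.
\<close>

record 'a fun_space =
  fs_measure :: "'a measure"
  fs_elems :: "('a \<Rightarrow> real) set"
  fs_norm :: "('a \<Rightarrow> real) \<Rightarrow> ennreal"

definition HTL_norm ::
    "('a \<Rightarrow> 'a \<Rightarrow> real) \<Rightarrow> 'a measure \<Rightarrow> real \<Rightarrow> real \<Rightarrow> ennreal \<Rightarrow> ('a \<Rightarrow> real) \<Rightarrow> ennreal" where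
  "HTL_norm d m \<alpha> p q u =
     Lp_fun_norm m p u +
     (INF g\<in>hajlasz_grads d m \<alpha> u. Lp_norm m p (\<lambda>x. lq_norm q (\<lambda>k. g k x)))"

definition HB_norm ::
    "('a \<Rightarrow> 'a \<Rightarrow> real) \<Rightarrow> 'a measure \<Rightarrow> real \<Rightarrow> real \<Rightarrow> ennreal \<Rightarrow> ('a \<Rightarrow> real) \<Rightarrow> ennreal" where
  "HB_norm d m \<alpha> p q u =
     Lp_fun_norm m p u +
     (INF g\<in>hajlasz_grads d m \<alpha> u. lq_norm q (\<lambda>k. Lp_norm m p (g k)))"

definition HTL_space ::
    "('a \<Rightarrow> 'a \<Rightarrow> real) \<Rightarrow> 'a measure \<Rightarrow> real \<Rightarrow> real \<Rightarrow> ennreal \<Rightarrow> 'a fun_space" where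
  "HTL_space d m \<alpha> p q =
     \<lparr>fs_measure = m,
      fs_elems = {u \<in> borel_measurable m. Lp_fun_norm m p u < \<infinity> \<and> HTL_norm d m \<alpha> p q u < \<infinity>},
      fs_norm = HTL_norm d m \<alpha> p q\<rparr>"

definition HB_space ::
    "('a \<Rightarrow> 'a \<Rightarrow> real) \<Rightarrow> 'a measure \<Rightarrow> real \<Rightarrow> real \<Rightarrow> ennreal \<Rightarrow> 'a fun_space" where
  "HB_space d m \<alpha> p q =
     \<lparr>fs_measure = m,
      fs_elems = {u \<in> borel_measurable m. Lp_fun_norm m p u < \<infinity> \<and> HB_norm d m \<alpha> p q u < \<infinity>},
      fs_norm = HB_norm d m \<alpha> p q\<rparr>"

section \<open>Embeddings\<close>

text \<open>
  The first two conjuncts say that the identity on functions induces a well-defined map between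
  the spaces of almost-everywhere classes.
\<close>

definition continuous_embedding :: "'a fun_space \<Rightarrow> 'a fun_space \<Rightarrow> bool" where
  "continuous_embedding A B \<longleftrightarrow>
     fs_elems A \<subseteq> fs_elems B \<and>
     (\<forall>u\<in>fs_elems A. \<forall>v\<in>fs_elems A.
        (AE x in fs_measure A. u x = v x) \<longrightarrow> (AE x in fs_measure B. u x = v x)) \<and>
     (\<exists>C::real. 0 < C \<and> (\<forall>u\<in>fs_elems A. fs_norm B u \<le> ennreal C * fs_norm A u))"

definition fs_bounded :: "'a fun_space \<Rightarrow> ('a \<Rightarrow> real) set \<Rightarrow> bool" where
  "fs_bounded A S \<longleftrightarrow> S \<subseteq> fs_elems A \<and> (\<exists>R::real. \<forall>u\<in>S. fs_norm A u \<le> ennreal R)"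

definition fs_totally_bounded :: "'a fun_space \<Rightarrow> ('a \<Rightarrow> real) set \<Rightarrow> bool" where
  "fs_totally_bounded B S \<longleftrightarrow>
     S \<subseteq> fs_elems B \<and>
     (\<forall>\<epsilon>::real. 0 < \<epsilon> \<longrightarrow>
        (\<exists>F. finite F \<and> F \<subseteq> fs_elems B \<and>
           (\<forall>u\<in>S. \<exists>f\<in>F. fs_norm B (\<lambda>x. u x - f x) < ennreal \<epsilon>)))"

definition compact_embedding :: "'a fun_space \<Rightarrow> 'a fun_space \<Rightarrow> bool" where
  "compact_embedding A B \<longleftrightarrow>
     continuous_embedding A B \<and> (\<forall>S. fs_bounded A S \<longrightarrow> fs_totally_bounded B S)"

end

theory Submission
  imports Defs
begin

text \<open>
  Compactness rests on two observations. First, the spaces and their exponents \<open>q\<close> differ only in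
  how the dyadic scales are combined, and \<open>\<beta> < \<alpha>\<close> leaves a geometric factor on each scale that
  makes any such combination harmless. A family bounded in either source
  space has gradients whose Lebesgue norms are bounded uniformly over all scales; with the geometric
  weights they are dominated on small scales by a single small function (\<open>Lp_norm_tail_sup\<close>), while
  on large scales the function itself bounds its differences. This gives the Ehrling type inequality
  \<open>hajlasz_interpolation\<close>: both target norms are at most \<open>\<eta>\<close> times the gradient bound plus a
  constant times the Lebesgue norm of exponent \<open>p'\<close>. So it suffices that the family is totally
  bounded in that Lebesgue space.

  Second, the positive finite measure of balls makes the space separable, so for every scale
  countably many cells of small diameter cover it (\<open>countable_cover_small_diameter\<close>). Finitely many
  of them carry almost all of the finite measure \<open>N\<close>, and off a small set each function of the family
  is bounded and almost constant on each cell; rounding its values to a grid leaves finitely many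
  patterns (\<open>finite_net_in_measure\<close>). Since \<open>p' < p\<close> and \<open>N\<close> is finite, closeness in measure becomes
  closeness in norm (\<open>finite_net_in_Lp\<close>).

  For the converse, a smoothness not above the index provides a function \<open>F\<close> that is comparable to a
  power \<open>a \<ge> \<alpha>\<close> of the distance to a base point and whose increments are bounded by that power of
  the distance: \<open>F\<close> is a chain distance, and the Frink chain inequality keeps it from collapsing
  (\<open>qm_exponent_distance_function\<close>). With \<open>m t\<close> the measure of \<open>{x. F x < t}\<close>, testing the embedding on cut-off
  functions between levels \<open>t\<close> and \<open>t + h\<close> gives
  \<open>m t powr (1 / p') \<le> H / h * m (t + h) powr (1 / p)\<close> for \<open>0 < h \<le> 1\<close>. Because \<open>1 / p' > 1 / p\<close>, a large
  value of \<open>m\<close> would improve itself along levels with summable steps and become infinite at a finite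
  level (\<open>bounded_of_self_improvement\<close>), which the finite measure of balls excludes. Hence \<open>m\<close> is
  bounded, and the whole space has finite measure.
\<close>

section \<open>Powers on the extended half-line\<close>

lemma epowr_ennreal: "0 \<le> x \<Longrightarrow> epowr (ennreal x) p = ennreal (x powr p)"
  by (simp add: epowr_def)

lemma epowr_top [simp]: "epowr \<infinity> p = \<infinity>" "epowr top p = top"
  by (simp_all add: epowr_def infinity_ennreal_def)

lemma epowr_0 [simp]: "epowr 0 p = 0"
  by (simp add: epowr_def)

lemma epowr_less_top_iff [simp]: "epowr x p < top \<longleftrightarrow> x < top"
  by (auto simp: epowr_def infinity_ennreal_def less_top)

lemma epowr_1 [simp]: "epowr x 1 = x"
  by (cases x) (auto simp: epowr_ennreal)

lemma epowr_mono: "0 \<le> p \<Longrightarrow> x \<le> y \<Longrightarrow> epowr x p \<le> epowr y p"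
  by (cases x; cases y) (auto simp: epowr_ennreal top_unique intro!: ennreal_leI powr_mono2)

lemma epowr_mult: "0 < p \<Longrightarrow> epowr (x * y) p = epowr x p * epowr y p"
  by (cases x; cases y)
     (auto simp: epowr_ennreal ennreal_mult_top ennreal_top_mult powr_mult simp flip: ennreal_mult)

lemma epowr_epowr: "epowr (epowr x p) s = epowr x (p * s)"
  by (cases x) (auto simp: epowr_ennreal powr_powr)

lemma epowr_inverse [simp]:
  "p \<noteq> 0 \<Longrightarrow> epowr (epowr x p) (1 / p) = x" "p \<noteq> 0 \<Longrightarrow> epowr (epowr x (1 / p)) p = x"
  by (simp_all add: epowr_epowr)

lemma epowr_le_iff: "0 < p \<Longrightarrow> epowr x p \<le> epowr y p \<longleftrightarrow> x \<le> y"
  using epowr_mono[of p x y] epowr_mono[of "1/p" "epowr x p" "epowr y p"] by auto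

lemma epowr_SUP_le_suminf:
  fixes f :: "nat \<Rightarrow> ennreal"
  assumes "0 < p"
  shows "epowr (SUP n. f n) p \<le> (\<Sum>n. epowr (f n) p)"
proof -
  have "f n \<le> epowr (\<Sum>n. epowr (f n) p) (1 / p)" for n
  proof -
    have "sum (\<lambda>k. epowr (f k) p) {n} \<le> (\<Sum>n. epowr (f n) p)"
      by (rule sum_le_suminf) auto
    then show ?thesis
      using epowr_mono[of "1/p" "epowr (f n) p"] assms by simp
  qed
  then have "(SUP n. f n) \<le> epowr (\<Sum>n. epowr (f n) p) (1 / p)"
    by (intro SUP_least)
  then show ?thesis
    using epowr_mono[of p "SUP n. f n"] assms by fastforce
qed

lemma epowr_add_le:
  assumes "0 < p"
  shows "epowr (x + y) p \<le> ennreal (2 powr p) * (epowr x p + epowr y p)"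
proof -
  have "x + y \<le> 2 * max x y"
    unfolding mult_2 by (intro add_mono) auto
  then have "epowr (x + y) p \<le> epowr (2 * max x y) p"
    using assms by (intro epowr_mono) auto
  also have "\<dots> = ennreal (2 powr p) * epowr (max x y) p"
    using assms epowr_ennreal[of 2 p] by (simp add: epowr_mult)
  also have "epowr (max x y) p \<le> epowr x p + epowr y p"
    by (auto simp: max_def)
  finally show ?thesis by (simp add: mult_left_mono)
qed

text \<open>
  This replaces Hoelder's inequality: integrated over a space of finite measure, it bounds the
  smaller power by the larger one, and for \<open>p' < p\<close> a large \<open>s\<close> makes the factor in front of the
  larger power small.
\<close>

lemma epowr_le_split:
  assumes "0 < p'" "p' \<le> p" "0 < s"
  shows "epowr t p' \<le> ennreal (s powr p') + ennreal (s powr (p' - p)) * epowr t p"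
proof (cases t)
  case (real t)
  show ?thesis
  proof (cases "t \<le> s")
    case True
    then have "t powr p' \<le> s powr p'" using real assms by (intro powr_mono2) auto
    then have "epowr (ennreal t) p' \<le> ennreal (s powr p')"
      using real by (simp add: epowr_ennreal ennreal_leI)
    then show ?thesis using real by (simp add: add_increasing2)
  next
    case False
    then have "t powr (p' - p) \<le> s powr (p' - p)" using assms by (intro powr_mono2') auto
    then have "t powr (p' - p) * t powr p \<le> s powr (p' - p) * t powr p"
      by (intro mult_right_mono) auto
    moreover have "t powr (p' - p) * t powr p = t powr p'"
      by (simp flip: powr_add)
    ultimately have "ennreal (t powr p') \<le> ennreal (s powr (p' - p)) * ennreal (t powr p)"
      by (simp add: ennreal_leI flip: ennreal_mult)
    then show ?thesis using real by (simp add: epowr_ennreal add_increasing)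
  qed
next
  case top
  then show ?thesis using assms by (simp add: ennreal_mult_top)
qed

lemma borel_measurable_epowr [measurable (raw)]:
  assumes [measurable]: "f \<in> borel_measurable M"
  shows "(\<lambda>x. epowr (f x) p) \<in> borel_measurable M"
  unfolding epowr_def by measurable

section \<open>Lebesgue quasi-norms\<close>

lemma Lp_norm_le_iff:
  "0 < p \<Longrightarrow> Lp_norm m p f \<le> c \<longleftrightarrow> (\<integral>\<^sup>+ x. epowr (f x) p \<partial>m) \<le> epowr c p"
  using epowr_le_iff[of "1/p" "\<integral>\<^sup>+ x. epowr (f x) p \<partial>m" "epowr c p"] by (simp add: Lp_norm_def)

lemma epowr_Lp_norm: "0 < p \<Longrightarrow> epowr (Lp_norm m p f) p = (\<integral>\<^sup>+ x. epowr (f x) p \<partial>m)"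
  by (simp add: Lp_norm_def)

lemma Lp_norm_mono:
  "0 < p \<Longrightarrow> (\<And>x. x \<in> space m \<Longrightarrow> f x \<le> g x) \<Longrightarrow> Lp_norm m p f \<le> Lp_norm m p g"
  unfolding Lp_norm_def by (intro epowr_mono nn_integral_mono) (auto simp: less_imp_le)

lemma Lp_norm_cmult:
  "0 < p \<Longrightarrow> f \<in> borel_measurable m \<Longrightarrow> Lp_norm m p (\<lambda>x. c * f x) = c * Lp_norm m p f"
  by (simp add: Lp_norm_def epowr_mult nn_integral_cmult)

lemma Lp_norm_add_le:
  assumes p: "0 < p" and [measurable]: "f \<in> borel_measurable m" "g \<in> borel_measurable m"
  shows "Lp_norm m p (\<lambda>x. f x + g x)
    \<le> ennreal (2 powr (1 + 1 / p)) * max (Lp_norm m p f) (Lp_norm m p g)"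
proof -
  have "(\<integral>\<^sup>+ x. epowr (f x + g x) p \<partial>m)
      \<le> (\<integral>\<^sup>+ x. ennreal (2 powr p) * (epowr (f x) p + epowr (g x) p) \<partial>m)"
    using p by (intro nn_integral_mono epowr_add_le)
  also have "\<dots> = ennreal (2 powr p) * (epowr (Lp_norm m p f) p + epowr (Lp_norm m p g) p)"
    using p by (simp add: nn_integral_cmult nn_integral_add epowr_Lp_norm)
  also have "\<dots> \<le> ennreal (2 powr p) * (2 * epowr (max (Lp_norm m p f) (Lp_norm m p g)) p)"
    unfolding mult_2
    by (intro mult_left_mono add_mono epowr_mono less_imp_le[OF p]) auto
  also have "\<dots> = epowr (ennreal (2 powr (1 + 1 / p)) * max (Lp_norm m p f) (Lp_norm m p g)) p"
  proof -
    have "2 powr ((1 + 1 / p) * p) = 2 powr p * (2::real)"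
      using p by (simp add: algebra_simps powr_add)
    then have "epowr (ennreal (2 powr (1 + 1 / p))) p = ennreal (2 powr p) * 2"
      by (simp only: epowr_ennreal powr_ge_zero powr_powr) (simp add: ennreal_mult)
    then show ?thesis using p by (simp add: epowr_mult mult.assoc)
  qed
  finally show ?thesis using p by (simp add: Lp_norm_le_iff)
qed

lemma Lp_norm_le_higher_exponent:
  assumes m: "finite_measure m" and p: "0 < p'" "p' \<le> p"
    and f: "f \<in> borel_measurable m" and le: "Lp_norm m p f \<le> R"
  shows "Lp_norm m p' f \<le> ennreal ((measure m (space m) + 1) powr (1 / p')) * R"
proof -
  interpret finite_measure m by fact
  define V where "V = measure m (space m)"
  have V: "emeasure m (space m) = ennreal V" "0 \<le> V"
    by (simp_all add: V_def emeasure_eq_measure)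
  note [measurable] = f
  have main: "Lp_norm m p' f \<le> ennreal ((V + 1) powr (1 / p')) * ennreal s"
    if "0 < s" and s: "Lp_norm m p f \<le> ennreal s" for s
  proof -
    have int: "(\<integral>\<^sup>+ x. epowr (f x) p \<partial>m) \<le> ennreal (s powr p)"
      using s p \<open>0 < s\<close> by (simp add: Lp_norm_le_iff epowr_ennreal)
    have "(\<integral>\<^sup>+ x. epowr (f x) p' \<partial>m)
        \<le> (\<integral>\<^sup>+ x. ennreal (s powr p') + ennreal (s powr (p' - p)) * epowr (f x) p \<partial>m)"
      using p \<open>0 < s\<close> by (intro nn_integral_mono epowr_le_split) auto
    also have "\<dots> = ennreal (s powr p') * ennreal V
        + ennreal (s powr (p' - p)) * (\<integral>\<^sup>+ x. epowr (f x) p \<partial>m)"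
      by (simp add: nn_integral_add nn_integral_cmult V)
    also have "\<dots> \<le> ennreal (s powr p') * ennreal V + ennreal (s powr (p' - p)) * ennreal (s powr p)"
      by (intro add_mono mult_left_mono int) auto
    also have "\<dots> = ennreal ((V + 1) * s powr p')"
      using V(2) \<open>0 < s\<close>
      by (simp add: algebra_simps flip: ennreal_mult ennreal_plus powr_add)
    also have "\<dots> = epowr (ennreal ((V + 1) powr (1 / p')) * ennreal s) p'"
      using p V(2) \<open>0 < s\<close> by (simp add: epowr_ennreal powr_powr powr_mult flip: ennreal_mult)
    finally show ?thesis using p by (simp add: Lp_norm_le_iff)
  qed
  show ?thesis
  proof (cases R)
    case (real r)
    have "Lp_norm m p' f \<le> ennreal ((V + 1) powr (1 / p')) * ennreal r + ennreal e"
      if "0 < e" for e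
    proof -
      define c where "c = (V + 1) powr (1 / p')"
      have "0 < c" using V(2) by (simp add: c_def)
      have "Lp_norm m p f \<le> ennreal (r + e / c)"
        using le real \<open>0 < e\<close> \<open>0 < c\<close> by (auto intro: order_trans[OF le] ennreal_leI)
      then have "Lp_norm m p' f \<le> ennreal c * ennreal (r + e / c)"
        using main[of "r + e / c"] real \<open>0 < e\<close> \<open>0 < c\<close> by (simp add: c_def add_nonneg_pos)
      also have "\<dots> = ennreal c * ennreal r + ennreal e"
        using real \<open>0 < e\<close> \<open>0 < c\<close>
        by (simp add: field_simps flip: ennreal_mult ennreal_plus)
      finally show ?thesis by (simp add: c_def)
    qed
    then show ?thesis using real by (auto simp: V_def intro: ennreal_le_epsilon)
  next
    case top
    have "ennreal ((V + 1) powr (1 / p')) \<noteq> 0" using V(2) by (simp add: ennreal_eq_0_iff)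
    then show ?thesis using top by (simp add: ennreal_mult_top V_def)
  qed
qed

lemma nn_integral_dominated_measure:
  assumes "sets N = sets M" "0 \<le> C" "f \<in> borel_measurable M"
    and "\<And>A. A \<in> sets M \<Longrightarrow> emeasure N A \<le> ennreal C * emeasure M A"
  shows "(\<integral>\<^sup>+ x. f x \<partial>N) \<le> ennreal C * (\<integral>\<^sup>+ x. f x \<partial>M)"
proof -
  have "N \<le> scale_measure (ennreal C) M"
    using assms by (subst le_measure) (auto)
  then have "(\<integral>\<^sup>+ x. f x \<partial>N) \<le> (\<integral>\<^sup>+ x. f x \<partial>scale_measure (ennreal C) M)"
    using assms by (intro nn_integral_mono_measure) auto
  also have "\<dots> = ennreal C * (\<integral>\<^sup>+ x. f x \<partial>M)"
    using assms by (intro nn_integral_scale_measure)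
  finally show ?thesis .
qed

lemma Lp_norm_dominated_measure:
  assumes "sets N = sets M" "0 \<le> C" "f \<in> borel_measurable M" "0 < p"
    and "\<And>A. A \<in> sets M \<Longrightarrow> emeasure N A \<le> ennreal C * emeasure M A"
  shows "Lp_norm N p f \<le> ennreal (C powr (1 / p)) * Lp_norm M p f"
proof -
  have "(\<integral>\<^sup>+ x. epowr (f x) p \<partial>N) \<le> ennreal C * (\<integral>\<^sup>+ x. epowr (f x) p \<partial>M)"
    using assms by (intro nn_integral_dominated_measure) auto
  also have "\<dots> = epowr (ennreal (C powr (1 / p)) * Lp_norm M p f) p"
    using assms by (simp add: epowr_mult epowr_Lp_norm epowr_ennreal powr_powr)
  finally show ?thesis using assms by (simp add: Lp_norm_le_iff)
qed

lemma emeasure_gt_le_Lp_norm: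
  assumes f: "f \<in> borel_measurable m" and p: "0 < p" and l: "0 < l" and c: "0 \<le> c"
    and le: "Lp_norm m p f \<le> ennreal c"
  shows "emeasure m {x \<in> space m. ennreal l < f x} \<le> ennreal ((c / l) powr p)"
proof -
  note [measurable] = f
  have "{x \<in> space m. ennreal l < f x}
      \<subseteq> {x \<in> space m. 1 \<le> ennreal (l powr - p) * epowr (f x) p}"
  proof safe
    fix x assume "ennreal l < f x"
    then have "epowr (ennreal l) p \<le> epowr (f x) p"
      using p by (intro epowr_mono) auto
    then have "ennreal (l powr - p) * ennreal (l powr p) \<le> ennreal (l powr - p) * epowr (f x) p"
      using l by (intro mult_left_mono) (simp_all add: epowr_ennreal)
    then show "1 \<le> ennreal (l powr - p) * epowr (f x) p"
      using l by (simp flip: ennreal_mult powr_add)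
  qed
  then have "emeasure m {x \<in> space m. ennreal l < f x}
      \<le> emeasure m ({x \<in> space m. 1 \<le> ennreal (l powr - p) * epowr (f x) p})"
    by (intro emeasure_mono) auto
  also have "\<dots> \<le> ennreal (l powr - p) * (\<integral>\<^sup>+ x. epowr (f x) p * indicator (space m) x \<partial>m)"
    using nn_integral_Markov_inequality[of "\<lambda>x. epowr (f x) p" "space m" m "ennreal (l powr - p)"]
    by (simp add: Int_def conj_commute)
  also have "(\<integral>\<^sup>+ x. epowr (f x) p * indicator (space m) x \<partial>m) = (\<integral>\<^sup>+ x. epowr (f x) p \<partial>m)"
    by (intro nn_integral_cong) auto
  also have "ennreal (l powr - p) * (\<integral>\<^sup>+ x. epowr (f x) p \<partial>m) \<le> ennreal (l powr - p) * ennreal (c powr p)"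
    using le p c by (intro mult_left_mono) (simp_all add: Lp_norm_le_iff epowr_ennreal)
  also have "\<dots> = ennreal ((c / l) powr p)"
    using l c by (simp add: powr_divide powr_minus field_simps flip: ennreal_mult)
  finally show ?thesis .
qed

section \<open>Sequence quasi-norms\<close>

lemma le_lq_norm:
  assumes "0 < q"
  shows "a k \<le> lq_norm q a"
proof (cases "q = \<infinity>")
  case True
  then show ?thesis by (auto simp: lq_norm_def intro: SUP_upper)
next
  case False
  then have q: "0 < enn2real q" using assms by (simp add: enn2real_positive_iff less_top)
  have "epowr (a k) (enn2real q) \<le> (\<integral>\<^sup>+ k. epowr (a k) (enn2real q) \<partial>count_space UNIV)"
    by (rule nn_integral_ge_point) simp
  then show ?thesis
    using epowr_mono[of "1 / enn2real q" "epowr (a k) (enn2real q)"] q False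
    by (simp add: lq_norm_def)
qed

lemma lq_norm_multc:
  assumes "0 < q"
  shows "lq_norm q (\<lambda>k. a k * c) = lq_norm q a * c"
proof (cases "q = \<infinity>")
  case True
  then show ?thesis by (simp add: lq_norm_def SUP_mult_right_ennreal)
next
  case False
  then have "0 < enn2real q" using assms by (simp add: enn2real_positive_iff less_top)
  then show ?thesis using False by (simp add: lq_norm_def epowr_mult nn_integral_multc)
qed

definition two_sided_geometric :: "real \<Rightarrow> int \<Rightarrow> ennreal" where
  "two_sided_geometric \<delta> k = ennreal (2 powr (- \<delta> * \<bar>real_of_int k\<bar>))"

lemma two_sided_geometric_le_1: "0 \<le> \<delta> \<Longrightarrow> two_sided_geometric \<delta> k \<le> 1"
  using powr_le_cancel_iff[of 2 "- \<delta> * \<bar>real_of_int k\<bar>" 0]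
  by (simp add: two_sided_geometric_def)

lemma nn_integral_two_sided_geometric:
  assumes "0 < \<delta>"
  shows "(\<integral>\<^sup>+ k. two_sided_geometric \<delta> k \<partial>count_space UNIV) < \<infinity>"
proof -
  define S where "S = (\<Sum>n. ennreal ((2 powr - \<delta>) ^ n))"
  have eq: "two_sided_geometric \<delta> (int n) = ennreal ((2 powr - \<delta>) ^ n)"
    "two_sided_geometric \<delta> (- int n) = ennreal ((2 powr - \<delta>) ^ n)" for n
    by (simp_all add: two_sided_geometric_def powr_powr flip: powr_realpow)
  have "2 powr - \<delta> < (1::real)" using assms by (simp add: powr_less_one)
  then have S: "S < \<infinity>"
    unfolding S_def by (subst suminf_ennreal2) (auto intro!: summable_geometric)
  have int: "(\<integral>\<^sup>+ k. two_sided_geometric \<delta> k \<partial>count_space A) = S"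
    if "bij_betw f UNIV A" "\<And>n. two_sided_geometric \<delta> (f n) = ennreal ((2 powr - \<delta>) ^ n)"
    for A and f :: "nat \<Rightarrow> int"
    using nn_integral_bij_count_space[OF that(1), of "two_sided_geometric \<delta>"] that(2)
    by (simp add: nn_integral_count_space_nat S_def)
  have pos: "(\<integral>\<^sup>+ k. two_sided_geometric \<delta> k \<partial>count_space {0..}) = S"
    by (rule int[of int], rule bij_betwI[where g = nat]) (auto simp: eq)
  have neg: "(\<integral>\<^sup>+ k. two_sided_geometric \<delta> k \<partial>count_space {..0}) = S"
    by (rule int[of "\<lambda>n. - int n"]) (auto simp: eq intro!: bij_betwI[where g = "\<lambda>k. nat (- k)"])
  have "(\<integral>\<^sup>+ k. two_sided_geometric \<delta> k \<partial>count_space UNIV)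
      \<le> (\<integral>\<^sup>+ k. two_sided_geometric \<delta> k * indicator {0..} k
            + two_sided_geometric \<delta> k * indicator {..0} k \<partial>count_space UNIV)"
    by (intro nn_integral_mono) (auto simp: indicator_def)
  also have "\<dots> = (\<integral>\<^sup>+ k. two_sided_geometric \<delta> k \<partial>count_space {0..})
      + (\<integral>\<^sup>+ k. two_sided_geometric \<delta> k \<partial>count_space {..0})"
    by (simp add: nn_integral_add nn_integral_count_space_indicator)
  finally show ?thesis using S by (simp add: pos neg le_less_trans)
qed

text \<open>
  The degenerate rate \<open>\<delta> = 0\<close> is what remains when the smoothness equals the index of the space;
  it is summable in no sense but bounded, which is why that case needs \<open>q = \<infinity>\<close>.
\<close>

lemma lq_norm_two_sided_geometric:
  assumes "0 < q" "0 \<le> \<delta>" "0 < \<delta> \<or> q = \<infinity>"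
  shows "lq_norm q (two_sided_geometric \<delta>) < \<infinity>"
proof (cases "q = \<infinity>")
  case True
  have "(SUP k. two_sided_geometric \<delta> k) \<le> 1"
    using assms by (intro SUP_least two_sided_geometric_le_1)
  then show ?thesis using True by (auto simp: lq_norm_def intro: le_less_trans)
next
  case False
  then have q: "0 < enn2real q" using assms by (simp add: enn2real_positive_iff less_top)
  have "epowr (two_sided_geometric \<delta> k) (enn2real q) = two_sided_geometric (\<delta> * enn2real q) k" for k
    by (simp add: two_sided_geometric_def epowr_ennreal powr_powr mult_ac)
  then show ?thesis
    using False nn_integral_two_sided_geometric[of "\<delta> * enn2real q"] q assms
    by (simp add: lq_norm_def)
qed

section \<open>Hajlasz gradients\<close>

lemma dyadic_shell_powr:
  fixes t :: real
  assumes "2 powi (- k - 1) \<le> t \<and> t < 2 powi (- k)" "0 \<le> a"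
  shows "0 < t" "t powr a \<le> 2 powr (- a * k)" "2 powr (- a * (k + 1)) \<le> t powr a"
proof -
  have *: "2 powr (- (k + 1)) \<le> t" "t < 2 powr (- k)"
    using assms powr_real_of_int'[of 2 "- k - 1"] powr_real_of_int'[of 2 "- k"] by auto
  then show "0 < t" by (smt (verit) powr_gt_zero)
  then have "t powr a \<le> (2 powr (- k)) powr a" "(2 powr (- (k + 1))) powr a \<le> t powr a"
    using * \<open>0 \<le> a\<close> by (auto intro!: powr_mono2)
  then show "t powr a \<le> 2 powr (- a * k)" "2 powr (- a * (k + 1)) \<le> t powr a"
    by (simp_all add: powr_powr algebra_simps)
qed

lemma hajlasz_grads_measurable: "g \<in> hajlasz_grads d m \<alpha> u \<Longrightarrow> g k \<in> borel_measurable m"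
  by (simp add: hajlasz_grads_def)

lemma hajlasz_gradsI:
  assumes "\<And>k. g k \<in> borel_measurable m" "E \<in> null_sets m"
    "\<And>k x y. x \<in> space m - E \<Longrightarrow> y \<in> space m - E \<Longrightarrow>
      2 powi (- k - 1) \<le> d x y \<and> d x y < 2 powi (- k) \<Longrightarrow>
      ennreal \<bar>u x - u y\<bar> \<le> ennreal (d x y powr \<alpha>) * (g k x + g k y)"
  shows "g \<in> hajlasz_grads d m \<alpha> u"
  using assms unfolding hajlasz_grads_def by blast

lemma hajlasz_grads_diff:
  assumes "g \<in> hajlasz_grads d m \<alpha> u" "h \<in> hajlasz_grads d m \<alpha> v"
  shows "(\<lambda>k x. g k x + h k x) \<in> hajlasz_grads d m \<alpha> (\<lambda>x. u x - v x)"
proof -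
  obtain E where E: "E \<in> null_sets m"
    "\<forall>k. \<forall>x\<in>space m - E. \<forall>y\<in>space m - E.
      2 powi (- k - 1) \<le> d x y \<and> d x y < 2 powi (- k) \<longrightarrow>
      ennreal \<bar>u x - u y\<bar> \<le> ennreal (d x y powr \<alpha>) * (g k x + g k y)"
    using assms(1) unfolding hajlasz_grads_def by blast
  obtain E' where E': "E' \<in> null_sets m"
    "\<forall>k. \<forall>x\<in>space m - E'. \<forall>y\<in>space m - E'.
      2 powi (- k - 1) \<le> d x y \<and> d x y < 2 powi (- k) \<longrightarrow>
      ennreal \<bar>v x - v y\<bar> \<le> ennreal (d x y powr \<alpha>) * (h k x + h k y)"
    using assms(2) unfolding hajlasz_grads_def by blast
  show ?thesis
  proof (rule hajlasz_gradsI)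
    show "(\<lambda>x. g k x + h k x) \<in> borel_measurable m" for k
      using assms[THEN hajlasz_grads_measurable] by (intro borel_measurable_add) auto
    show "E \<union> E' \<in> null_sets m" using E(1) E'(1) by (rule null_sets.Un)
    fix k x y
    assume *: "x \<in> space m - (E \<union> E')" "y \<in> space m - (E \<union> E')"
      "2 powi (- k - 1) \<le> d x y \<and> d x y < 2 powi (- k)"
    have "ennreal \<bar>(u x - v x) - (u y - v y)\<bar> \<le> ennreal (\<bar>u x - u y\<bar> + \<bar>v x - v y\<bar>)"
      by (intro ennreal_leI) auto
    also have "\<dots> = ennreal \<bar>u x - u y\<bar> + ennreal \<bar>v x - v y\<bar>"
      by simp
    also have "\<dots> \<le> ennreal (d x y powr \<alpha>) * (g k x + g k y)
        + ennreal (d x y powr \<alpha>) * (h k x + h k y)"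
      using * by (intro add_mono E(2)[rule_format] E'(2)[rule_format]) auto
    finally show "ennreal \<bar>(u x - v x) - (u y - v y)\<bar>
        \<le> ennreal (d x y powr \<alpha>) * (g k x + h k x + (g k y + h k y))"
      by (simp add: algebra_simps)
  qed
qed

lemma hajlasz_grads_dominated_measure:
  assumes "sets N = sets M" and "\<And>A. A \<in> sets M \<Longrightarrow> emeasure N A \<le> ennreal C * emeasure M A"
    and g: "g \<in> hajlasz_grads d M \<alpha> u"
  shows "g \<in> hajlasz_grads d N \<alpha> u"
proof -
  have sp: "space N = space M" using assms(1) by (rule sets_eq_imp_space_eq)
  obtain E where E: "E \<in> null_sets M"
    "\<forall>k. \<forall>x\<in>space M - E. \<forall>y\<in>space M - E.
      2 powi (- k - 1) \<le> d x y \<and> d x y < 2 powi (- k) \<longrightarrow>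
      ennreal \<bar>u x - u y\<bar> \<le> ennreal (d x y powr \<alpha>) * (g k x + g k y)"
    using g unfolding hajlasz_grads_def by blast
  have "E \<in> null_sets N"
    using E(1) assms(1) assms(2)[of E] by (auto simp: null_sets_def)
  then show ?thesis
    using E(2)[rule_format] hajlasz_grads_measurable[OF g] assms(1)
    by (intro hajlasz_gradsI[where E = E]) (auto simp: sp cong: measurable_cong_sets)
qed

text \<open>
  Every sequence quasi-norm dominates each term. Hence a bound in either scale controls the
  Lebesgue norms of the single functions \<open>g\<^sub>k\<close> uniformly in \<open>k\<close>, that is, the Besov norm with
  exponent \<open>q = \<infinity>\<close>; compactness is proved from this information alone.
\<close>

lemma Lp_fun_norm_le_HTL_HB_norm:
  "Lp_fun_norm m p u \<le> HTL_norm d m \<alpha> p q u" "Lp_fun_norm m p u \<le> HB_norm d m \<alpha> p q u"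
  by (simp_all add: HTL_norm_def HB_norm_def)

lemma HTL_norm_controls_grads:
  assumes "0 < p" "0 < q" "HTL_norm d m \<alpha> p q u < s"
  shows "\<exists>g\<in>hajlasz_grads d m \<alpha> u. \<forall>k. Lp_norm m p (g k) \<le> s"
proof -
  have "(INF g\<in>hajlasz_grads d m \<alpha> u. Lp_norm m p (\<lambda>x. lq_norm q (\<lambda>k. g k x))) < s"
    using assms(3) unfolding HTL_norm_def by (rule le_less_trans[rotated]) simp
  then obtain g where g: "g \<in> hajlasz_grads d m \<alpha> u" "Lp_norm m p (\<lambda>x. lq_norm q (\<lambda>k. g k x)) < s"
    by (auto simp: INF_less_iff)
  have "Lp_norm m p (g k) \<le> Lp_norm m p (\<lambda>x. lq_norm q (\<lambda>k. g k x))" for k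
    using assms le_lq_norm[of q "\<lambda>k. g k x" k for x] by (intro Lp_norm_mono) auto
  then show ?thesis using g by (meson less_imp_le order_trans)
qed

lemma HB_norm_controls_grads:
  assumes "0 < q" "HB_norm d m \<alpha> p q u < s"
  shows "\<exists>g\<in>hajlasz_grads d m \<alpha> u. \<forall>k. Lp_norm m p (g k) \<le> s"
proof -
  have "(INF g\<in>hajlasz_grads d m \<alpha> u. lq_norm q (\<lambda>k. Lp_norm m p (g k))) < s"
    using assms(2) unfolding HB_norm_def by (rule le_less_trans[rotated]) simp
  then obtain g where g: "g \<in> hajlasz_grads d m \<alpha> u" "lq_norm q (\<lambda>k. Lp_norm m p (g k)) < s"
    by (auto simp: INF_less_iff)
  then show ?thesis
    using le_lq_norm[OF assms(1), of "\<lambda>k. Lp_norm m p (g k)"]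
    by (meson less_imp_le order_trans)
qed

text \<open>
  For gradients of the form \<open>c\<^sub>k G\<close> with a fixed function \<open>G\<close>, the order in which the sequence and
  the Lebesgue quasi-norm are taken is irrelevant, so both scales are estimated at once.
\<close>

lemma norms_le_of_product_gradient:
  assumes "0 < p" "0 < q" "G \<in> borel_measurable m" "E \<in> null_sets m"
    and "\<And>k x y. x \<in> space m - E \<Longrightarrow> y \<in> space m - E \<Longrightarrow>
      2 powi (- k - 1) \<le> d x y \<and> d x y < 2 powi (- k) \<Longrightarrow>
      ennreal \<bar>u x - u y\<bar> \<le> ennreal (d x y powr \<alpha>) * (c k * G x + c k * G y)"
  shows "HTL_norm d m \<alpha> p q u \<le> Lp_fun_norm m p u + lq_norm q c * Lp_norm m p G"
    and "HB_norm d m \<alpha> p q u \<le> Lp_fun_norm m p u + lq_norm q c * Lp_norm m p G"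
proof -
  have g: "(\<lambda>k x. c k * G x) \<in> hajlasz_grads d m \<alpha> u"
    using assms by (intro hajlasz_gradsI[where E = E]) auto
  show "HTL_norm d m \<alpha> p q u \<le> Lp_fun_norm m p u + lq_norm q c * Lp_norm m p G"
    unfolding HTL_norm_def using assms(1-3)
    by (intro add_left_mono INF_lower2[OF g]) (simp add: lq_norm_multc Lp_norm_cmult)
  show "HB_norm d m \<alpha> p q u \<le> Lp_fun_norm m p u + lq_norm q c * Lp_norm m p G"
    unfolding HB_norm_def using assms(1-3)
    by (intro add_left_mono INF_lower2[OF g]) (simp add: lq_norm_multc Lp_norm_cmult)
qed

definition tail_sup :: "real \<Rightarrow> nat \<Rightarrow> (int \<Rightarrow> 'a \<Rightarrow> ennreal) \<Rightarrow> 'a \<Rightarrow> ennreal" where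
  "tail_sup \<theta> K g x = (SUP n. ennreal (2 powr (- \<theta> * real (K + n))) * g (int (K + n)) x)"

lemma le_tail_sup:
  assumes "int K \<le> k"
  shows "ennreal (2 powr (- \<theta> * k)) * g k x \<le> tail_sup \<theta> K g x"
proof -
  define n where "n = nat (k - int K)"
  then have k: "k = int (K + n)" using assms by simp
  show ?thesis unfolding k tail_sup_def by (rule SUP_upper2[of n]) auto
qed

lemma borel_measurable_tail_sup:
  "(\<And>k. g k \<in> borel_measurable m) \<Longrightarrow> tail_sup \<theta> K g \<in> borel_measurable m"
  unfolding tail_sup_def by (intro borel_measurable_SUP borel_measurable_times) auto

text \<open>
  The geometric weights turn the uniform control of the norms of the \<open>g\<^sub>k\<close> into control of one
  function that dominates all weighted \<open>g\<^sub>k\<close> at small scales, with a norm that tends to zero with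
  the scale.
\<close>

lemma Lp_norm_tail_sup:
  fixes m :: "'a measure"
  assumes "0 < \<theta>" "0 < p"
  shows "\<exists>A>0. \<forall>g R K. (\<forall>k. g k \<in> borel_measurable m) \<longrightarrow> (\<forall>k. Lp_norm m p (g k) \<le> R) \<longrightarrow>
      Lp_norm m p (tail_sup \<theta> K g) \<le> ennreal (A * 2 powr (- \<theta> * real K)) * R"
proof -
  define y where "y = 2 powr (- \<theta> * p)"
  have y: "0 < y" "y < 1" using assms by (auto simp: y_def powr_less_one)
  define A where "A = (1 / (1 - y)) powr (1 / p)"
  have "0 < A" using y by (simp add: A_def)
  moreover have "Lp_norm m p (tail_sup \<theta> K g) \<le> ennreal (A * 2 powr (- \<theta> * real K)) * R"
    if [measurable]: "\<And>k. g k \<in> borel_measurable m" and R: "\<And>k. Lp_norm m p (g k) \<le> R"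
    for g R K
  proof -
    have w: "epowr (ennreal (2 powr (- \<theta> * real (K + n)))) p = ennreal (y powr real K) * ennreal (y ^ n)" for n
    proof -
      have "(2 powr (- \<theta> * real (K + n))) powr p = y powr real K * y ^ n"
        using y(1) by (simp add: y_def powr_powr algebra_simps flip: powr_realpow powr_add)
      then show ?thesis using y(1) by (simp add: epowr_ennreal ennreal_mult)
    qed
    have "(\<integral>\<^sup>+ x. epowr (tail_sup \<theta> K g x) p \<partial>m)
        \<le> (\<integral>\<^sup>+ x. (\<Sum>n. epowr (ennreal (2 powr (- \<theta> * real (K + n))) * g (int (K + n)) x) p) \<partial>m)"
      unfolding tail_sup_def using assms by (intro nn_integral_mono epowr_SUP_le_suminf)
    also have "\<dots> = (\<Sum>n. ennreal (y powr real K) * ennreal (y ^ n)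
        * (\<integral>\<^sup>+ x. epowr (g (int (K + n)) x) p \<partial>m))"
      using assms by (simp only: epowr_mult w) (simp add: nn_integral_suminf nn_integral_cmult)
    also have "\<dots> \<le> (\<Sum>n. ennreal (y powr real K) * ennreal (y ^ n) * epowr R p)"
      using R assms by (intro suminf_le mult_left_mono) (auto simp flip: Lp_norm_le_iff)
    also have "\<dots> = ennreal (y powr real K) * ennreal (1 / (1 - y)) * epowr R p"
    proof -
      have "(\<Sum>n. ennreal (y ^ n)) = ennreal (1 / (1 - y))"
        using y by (simp add: suminf_ennreal2 suminf_geometric summable_geometric)
      then show ?thesis by (simp add: ennreal_suminf_multc ennreal_suminf_cmult)
    qed
    also have "\<dots> = epowr (ennreal (A * 2 powr (- \<theta> * real K)) * R) p"
    proof -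
      have "(A * 2 powr (- \<theta> * real K)) powr p = y powr real K * (1 / (1 - y))"
        using y assms by (simp add: A_def y_def powr_mult powr_powr mult_ac)
      then show ?thesis
        using assms \<open>0 < A\<close> y by (simp add: epowr_mult epowr_ennreal flip: ennreal_mult)
    qed
    finally show ?thesis using assms by (simp add: Lp_norm_le_iff)
  qed
  ultimately show ?thesis by blast
qed

text \<open>
  An Ehrling type inequality: the loss of smoothness from \<open>\<alpha>\<close> to \<open>\<beta>\<close> pays for a gradient with
  geometric weights. At scales below \<open>2 powr (- K)\<close> the gradient of order \<open>\<alpha>\<close> is used, and the gain
  \<open>2 powr (- \<theta> * K)\<close> makes its contribution small; at larger scales \<open>\<bar>u x\<bar> + \<bar>u y\<bar>\<close> bounds the
  difference. Half of \<open>\<alpha> - \<beta>\<close> is spent on the supremum over \<open>k\<close> and half on summing over \<open>k\<close>.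
\<close>

lemma hajlasz_interpolation:
  assumes m: "finite_measure m" and \<beta>: "0 < \<beta>" "\<beta> < \<alpha>" and p: "0 < p'" "p' \<le> p"
    and r: "0 < r" and \<eta>: "0 < (\<eta>::real)"
  shows "\<exists>T>0. \<forall>u g R. u \<in> borel_measurable m \<longrightarrow> g \<in> hajlasz_grads d m \<alpha> u \<longrightarrow>
      (\<forall>k. Lp_norm m p (g k) \<le> R) \<longrightarrow>
      HTL_norm d m \<beta> p' r u \<le> ennreal \<eta> * R + ennreal T * Lp_fun_norm m p' u \<and>
      HB_norm d m \<beta> p' r u \<le> ennreal \<eta> * R + ennreal T * Lp_fun_norm m p' u"
proof -
  define \<theta> where "\<theta> = (\<alpha> - \<beta>) / 2"
  \<comment> \<open>The gain is \<open>2 powr (- \<theta> * k)\<close> towards small scales and \<open>2 powr (\<beta> * k)\<close> towards large ones,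
    where \<open>k < 0\<close>; the weights decay at the slower of the two rates on both sides.\<close>
  define \<delta> where "\<delta> = min \<theta> \<beta>"
  have \<theta>: "0 < \<theta>" "\<alpha> = \<beta> + 2 * \<theta>"
    using \<beta> by (auto simp: \<theta>_def field_simps)
  then have \<delta>: "0 < \<theta>" "0 < \<delta>" "\<delta> \<le> \<theta>" "\<delta> \<le> \<beta>" "\<alpha> = \<beta> + 2 * \<theta>"
    using \<beta>(1) by (auto simp: \<delta>_def)
  define c where "c = two_sided_geometric \<delta>"
  define L where "L = enn2real (lq_norm r c)"
  have L: "lq_norm r c = ennreal L" "0 \<le> L"
    using lq_norm_two_sided_geometric[OF r] \<delta> by (auto simp: c_def L_def less_top)
  define D where "D = (measure m (space m) + 1) powr (1 / p')"
  define Q where "Q = 2 powr (1 + 1 / p')"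
  have "0 < measure m (space m) + 1" by (simp add: add_nonneg_pos)
  then have pos: "0 < D" "0 < Q" by (simp_all add: D_def Q_def)
  have "0 < p" using p by simp
  from Lp_norm_tail_sup[OF \<theta>(1) this, of m]
  obtain A where "0 < A" and A: "\<forall>g R K. (\<forall>k. g k \<in> borel_measurable m) \<longrightarrow>
      (\<forall>k. Lp_norm m p (g k) \<le> R) \<longrightarrow>
      Lp_norm m p (tail_sup \<theta> K g) \<le> ennreal (A * 2 powr (- \<theta> * real K)) * R"
    by blast
  have "(\<lambda>K. (2 powr - \<theta>) ^ K) \<longlonglongrightarrow> 0"
    using \<theta>(1) by (intro LIMSEQ_realpow_zero) (auto simp: powr_less_one)
  from tendsto_mult_right_zero[OF this]
  have "(\<lambda>K. L * Q * D * A * (2 powr - \<theta>) ^ K) \<longlonglongrightarrow> 0" .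
  then have "\<forall>\<^sub>F K in sequentially. L * Q * D * A * (2 powr - \<theta>) ^ K < \<eta>"
    using \<eta> by (rule order_tendstoD(2))
  from eventually_happens'[OF sequentially_bot this]
  obtain K :: nat where "L * Q * D * A * (2 powr - \<theta>) ^ K < \<eta>"
    by blast
  then have K: "L * Q * D * (A * 2 powr (- \<theta> * real K)) \<le> \<eta>"
    by (simp add: powr_powr mult_ac flip: powr_realpow)
  \<comment> \<open>Large enough for \<open>1 \<le> d x y powr \<beta> * c k * T1\<close> on every shell with \<open>k < K\<close>.\<close>
  define T1 where "T1 = 2 powr ((real K + 1) * (\<beta> + \<delta>))"
  have "0 < T1" by (simp add: T1_def)
  define T where "T = 1 + L * Q * T1"
  have "0 < T" using pos L \<open>0 < T1\<close> by (auto simp: T_def add_pos_nonneg)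
  moreover have "HTL_norm d m \<beta> p' r u \<le> ennreal \<eta> * R + ennreal T * Lp_fun_norm m p' u \<and>
      HB_norm d m \<beta> p' r u \<le> ennreal \<eta> * R + ennreal T * Lp_fun_norm m p' u"
    if u [measurable]: "u \<in> borel_measurable m" and g: "g \<in> hajlasz_grads d m \<alpha> u"
      and R: "\<And>k. Lp_norm m p (g k) \<le> R" for u g R
  proof -
    define G where "G x = tail_sup \<theta> K g x + ennreal T1 * ennreal \<bar>u x\<bar>" for x
    note gm = hajlasz_grads_measurable[OF g]
    note [measurable] = borel_measurable_tail_sup[of g m \<theta> K, OF gm]
    have G [measurable]: "G \<in> borel_measurable m" unfolding G_def by measurable
    obtain E where E: "E \<in> null_sets m"
      "\<forall>k. \<forall>x\<in>space m - E. \<forall>y\<in>space m - E.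
        2 powi (- k - 1) \<le> d x y \<and> d x y < 2 powi (- k) \<longrightarrow>
        ennreal \<bar>u x - u y\<bar> \<le> ennreal (d x y powr \<alpha>) * (g k x + g k y)"
      using g unfolding hajlasz_grads_def by blast
    have pw: "ennreal \<bar>u x - u y\<bar> \<le> ennreal (d x y powr \<beta>) * (c k * G x + c k * G y)"
      if xy: "x \<in> space m - E" "y \<in> space m - E"
        and sh: "2 powi (- k - 1) \<le> d x y \<and> d x y < 2 powi (- k)" for k x y
    proof (cases "int K \<le> k")
      case True
      have dom: "d x y powr \<alpha> \<le> d x y powr \<beta> * (2 powr (- \<delta> * \<bar>real_of_int k\<bar>) * 2 powr (- \<theta> * k))"
      proof -
        have "d x y powr (2 * \<theta>) \<le> 2 powr (- (2 * \<theta>) * k)"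
          using dyadic_shell_powr(2)[OF sh, of "2 * \<theta>"] \<delta> by simp
        also have "\<dots> \<le> 2 powr (- \<delta> * k - \<theta> * k)"
          using True \<delta>(3) mult_right_mono[of \<delta> \<theta> "real_of_int k"] by (intro powr_mono) auto
        finally have "d x y powr \<beta> * d x y powr (2 * \<theta>) \<le> d x y powr \<beta> * 2 powr (- \<delta> * k - \<theta> * k)"
          by (intro mult_left_mono) auto
        moreover have "2 powr (- \<delta> * k - \<theta> * k) = 2 powr (- \<delta> * \<bar>real_of_int k\<bar>) * 2 powr (- \<theta> * k)"
          using True by (simp flip: powr_add)
        moreover have "d x y powr \<alpha> = d x y powr \<beta> * d x y powr (2 * \<theta>)"
          unfolding \<delta>(5) by (rule powr_add)
        ultimately show ?thesis by simp
      qed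
      have wt: "ennreal (2 powr (- \<theta> * k)) * g k z \<le> G z" for z
        using le_tail_sup[OF True, of \<theta> g z] by (simp add: G_def add_increasing2)
      have "ennreal \<bar>u x - u y\<bar> \<le> ennreal (d x y powr \<alpha>) * (g k x + g k y)"
        by (rule E(2)[rule_format, OF xy sh])
      also have "\<dots> \<le> ennreal (d x y powr \<beta> * (2 powr (- \<delta> * \<bar>real_of_int k\<bar>) * 2 powr (- \<theta> * k)))
          * (g k x + g k y)"
        by (intro mult_right_mono ennreal_leI dom) auto
      also have "\<dots> = ennreal (d x y powr \<beta>) * (c k * (ennreal (2 powr (- \<theta> * k)) * g k x)
          + c k * (ennreal (2 powr (- \<theta> * k)) * g k y))"
        by (simp add: c_def two_sided_geometric_def ennreal_mult algebra_simps)
      also have "\<dots> \<le> ennreal (d x y powr \<beta>) * (c k * G x + c k * G y)"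
        by (intro mult_left_mono add_mono wt) auto
      finally show ?thesis .
    next
      case False
      have "0 \<le> - \<beta> * (k + 1) - \<delta> * \<bar>real_of_int k\<bar> + (real K + 1) * (\<beta> + \<delta>)"
      proof (cases "0 \<le> k")
        case True
        have "real_of_int k + 1 \<le> real K" using False by linarith
        then have "(real_of_int k + 1) * (\<beta> + \<delta>) \<le> real K * (\<beta> + \<delta>)"
          using \<beta> \<delta> by (intro mult_right_mono) auto
        then show ?thesis using True \<beta> \<delta> by (simp add: algebra_simps)
      next
        case neg: False
        have "0 \<le> (\<beta> - \<delta>) * - real_of_int k"
          using neg \<delta> by (intro mult_nonneg_nonneg) auto
        moreover have "0 \<le> real K * (\<beta> + \<delta>)"
          using \<beta> \<delta> by (intro mult_nonneg_nonneg) auto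
        moreover have "- \<beta> * (k + 1) - \<delta> * \<bar>real_of_int k\<bar> + (real K + 1) * (\<beta> + \<delta>)
            = (\<beta> - \<delta>) * - real_of_int k + real K * (\<beta> + \<delta>) + \<delta>"
          using neg by (simp add: algebra_simps)
        ultimately show ?thesis using \<delta>(2) by linarith
      qed
      then have "1 \<le> 2 powr (- \<beta> * (k + 1) - \<delta> * \<bar>real_of_int k\<bar> + (real K + 1) * (\<beta> + \<delta>))"
        by (intro ge_one_powr_ge_zero) auto
      also have "\<dots> = 2 powr (- \<beta> * (k + 1)) * 2 powr (- \<delta> * \<bar>real_of_int k\<bar>) * T1"
        unfolding T1_def powr_add[symmetric] by simp
      also have "\<dots> \<le> d x y powr \<beta> * 2 powr (- \<delta> * \<bar>real_of_int k\<bar>) * T1"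
        using dyadic_shell_powr(3)[OF sh, of \<beta>] \<beta> \<open>0 < T1\<close> by (intro mult_right_mono) auto
      finally have one: "1 \<le> ennreal (d x y powr \<beta>) * (c k * ennreal T1)"
        using \<open>0 < T1\<close> by (simp add: c_def two_sided_geometric_def mult_ac flip: ennreal_mult)
      have "ennreal \<bar>u x - u y\<bar> \<le> ennreal (\<bar>u x\<bar> + \<bar>u y\<bar>)"
        by (intro ennreal_leI) auto
      also have "\<dots> = 1 * (ennreal \<bar>u x\<bar> + ennreal \<bar>u y\<bar>)" by simp
      also have "\<dots> \<le> ennreal (d x y powr \<beta>) * (c k * ennreal T1) * (ennreal \<bar>u x\<bar> + ennreal \<bar>u y\<bar>)"
        by (intro mult_right_mono one) auto
      also have "\<dots> = ennreal (d x y powr \<beta>) * (c k * (ennreal T1 * ennreal \<bar>u x\<bar>)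
          + c k * (ennreal T1 * ennreal \<bar>u y\<bar>))"
        by (simp add: algebra_simps)
      also have "\<dots> \<le> ennreal (d x y powr \<beta>) * (c k * G x + c k * G y)"
        unfolding G_def by (intro mult_left_mono add_mono) auto
      finally show ?thesis .
    qed
    have tail: "Lp_norm m p' (tail_sup \<theta> K g) \<le> ennreal D * (ennreal (A * 2 powr (- \<theta> * real K)) * R)"
      unfolding D_def using m p gm R A
      by (intro Lp_norm_le_higher_exponent borel_measurable_tail_sup) auto
    have "Lp_norm m p' G \<le> ennreal Q * max (Lp_norm m p' (tail_sup \<theta> K g))
        (Lp_norm m p' (\<lambda>x. ennreal T1 * ennreal \<bar>u x\<bar>))"
      unfolding G_def Q_def using p by (intro Lp_norm_add_le) auto
    also have "\<dots> \<le> ennreal Q * (ennreal D * (ennreal (A * 2 powr (- \<theta> * real K)) * R)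
        + ennreal T1 * Lp_fun_norm m p' u)"
      using p tail by (intro mult_left_mono)
        (auto simp: Lp_norm_cmult Lp_fun_norm_def intro: add_increasing add_increasing2)
    finally have "ennreal L * Lp_norm m p' G \<le> ennreal L * (ennreal Q *
        (ennreal D * (ennreal (A * 2 powr (- \<theta> * real K)) * R) + ennreal T1 * Lp_fun_norm m p' u))"
      by (intro mult_left_mono) auto
    also have "\<dots> = ennreal (L * Q * D * (A * 2 powr (- \<theta> * real K))) * R
        + ennreal (L * Q * T1) * Lp_fun_norm m p' u"
      using pos L \<open>0 < T1\<close> \<open>0 < A\<close> by (simp add: ennreal_mult algebra_simps)
    also have "\<dots> \<le> ennreal \<eta> * R + ennreal (L * Q * T1) * Lp_fun_norm m p' u"
      by (intro add_right_mono mult_right_mono ennreal_leI K) auto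
    finally have "Lp_fun_norm m p' u + ennreal L * Lp_norm m p' G
        \<le> Lp_fun_norm m p' u + (ennreal \<eta> * R + ennreal (L * Q * T1) * Lp_fun_norm m p' u)"
      by (rule add_left_mono)
    also have "\<dots> = ennreal \<eta> * R + ennreal T * Lp_fun_norm m p' u"
      using pos L \<open>0 < T1\<close> by (simp add: T_def algebra_simps)
    finally have "Lp_fun_norm m p' u + lq_norm r c * Lp_norm m p' G
        \<le> ennreal \<eta> * R + ennreal T * Lp_fun_norm m p' u"
      by (simp add: L)
    then show ?thesis
      using norms_le_of_product_gradient[of p' r G m E d u \<beta> c, OF p(1) r G E(1) pw]
      by (meson order_trans)
  qed
  ultimately show ?thesis by blast
qed

section \<open>Total boundedness in Lebesgue spaces\<close>

lemma quasi_metric_constants: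
  assumes "quasi_metric X d"
  shows "\<exists>C0\<ge>1. \<exists>C1\<ge>1. (\<forall>x\<in>X. \<forall>y\<in>X. d y x \<le> C0 * d x y) \<and>
    (\<forall>x\<in>X. \<forall>y\<in>X. \<forall>z\<in>X. d x y \<le> C1 * max (d x z) (d z y))"
proof -
  obtain C0 C1 where C: "\<forall>x\<in>X. \<forall>y\<in>X. d y x \<le> C0 * d x y"
    "\<forall>x\<in>X. \<forall>y\<in>X. \<forall>z\<in>X. d x y \<le> C1 * max (d x z) (d z y)"
    and d: "\<forall>x\<in>X. \<forall>y\<in>X. 0 \<le> d x y"
    using assms unfolding quasi_metric_def by blast
  have "d y x \<le> max C0 1 * d x y" if xy: "x \<in> X" "y \<in> X" for x y
  proof -
    have "d y x \<le> C0 * d x y" using C xy by blast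
    also have "\<dots> \<le> max C0 1 * d x y" using d xy by (intro mult_right_mono) auto
    finally show ?thesis .
  qed
  moreover have "d x y \<le> max C1 1 * max (d x z) (d z y)" if xyz: "x \<in> X" "y \<in> X" "z \<in> X" for x y z
  proof -
    have "d x y \<le> C1 * max (d x z) (d z y)" using C xyz by blast
    also have "\<dots> \<le> max C1 1 * max (d x z) (d z y)"
      using d xyz by (intro mult_right_mono) (auto simp: le_max_iff_disj)
    finally show ?thesis .
  qed
  ultimately show ?thesis
    by (intro exI[of _ "max C0 1"] exI[of _ "max C1 1"] conjI ballI) auto
qed

lemma maximal_separated_set:
  fixes d :: "'a \<Rightarrow> 'a \<Rightarrow> real"
  shows "\<exists>Z\<subseteq>X. (\<forall>z\<in>Z. \<forall>w\<in>Z. z \<noteq> w \<longrightarrow> \<rho> \<le> d z w) \<and>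
    (\<forall>x\<in>X - Z. \<exists>z\<in>Z. d x z < \<rho> \<or> d z x < \<rho>)"
proof -
  define \<A> where "\<A> = {Z. Z \<subseteq> X \<and> (\<forall>z\<in>Z. \<forall>w\<in>Z. z \<noteq> w \<longrightarrow> \<rho> \<le> d z w)}"
  have "\<exists>Z\<in>\<A>. \<forall>Y\<in>\<A>. Z \<subseteq> Y \<longrightarrow> Y = Z"
  proof (rule subset_Zorn_nonempty)
    show "\<A> \<noteq> {}" by (auto simp: \<A>_def)
    fix \<C> assume "\<C> \<noteq> {}" and ch: "subset.chain \<A> \<C>"
    have "\<rho> \<le> d z w" if "z \<in> \<Union>\<C>" "w \<in> \<Union>\<C>" "z \<noteq> w" for z w
    proof -
      from that(1) obtain A where A: "z \<in> A" "A \<in> \<C>" by blast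
      from that(2) obtain B where B: "w \<in> B" "B \<in> \<C>" by blast
      have "A \<subseteq> B \<or> B \<subseteq> A" using ch A(2) B(2) unfolding subset_chain_def by blast
      then obtain Y where Y: "Y \<in> \<C>" "z \<in> Y" "w \<in> Y" using A B by (meson subsetD)
      then have "Y \<in> \<A>" using ch unfolding subset_chain_def by blast
      then show ?thesis using Y(2,3) that(3) unfolding \<A>_def by blast
    qed
    moreover have "\<Union>\<C> \<subseteq> X"
      using ch unfolding subset_chain_def \<A>_def by blast
    ultimately show "\<Union>\<C> \<in> \<A>" by (auto simp: \<A>_def)
  qed
  then obtain Z where Z: "Z \<in> \<A>" and max: "\<And>Y. Y \<in> \<A> \<Longrightarrow> Z \<subseteq> Y \<Longrightarrow> Y = Z" by blast
  have "\<exists>z\<in>Z. d x z < \<rho> \<or> d z x < \<rho>" if x: "x \<in> X - Z" for x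
  proof -
    have "insert x Z \<notin> \<A>" using max[of "insert x Z"] x by blast
    then obtain z where "z \<in> Z" "\<not> \<rho> \<le> d x z \<or> \<not> \<rho> \<le> d z x"
      using x Z unfolding \<A>_def by blast
    then show ?thesis unfolding not_le by blast
  qed
  then have "\<forall>x\<in>X - Z. \<exists>z\<in>Z. d x z < \<rho> \<or> d z x < \<rho>" ..
  moreover have "Z \<subseteq> X" "\<forall>z\<in>Z. \<forall>w\<in>Z. z \<noteq> w \<longrightarrow> \<rho> \<le> d z w"
    using Z by (simp_all add: \<A>_def)
  ultimately show ?thesis by (intro exI[of _ Z] conjI)
qed

lemma countable_disjoint_positive_measure:
  assumes B: "B \<in> fmeasurable M" and f: "\<And>z. z \<in> Z \<Longrightarrow> f z \<in> sets M" "\<And>z. z \<in> Z \<Longrightarrow> f z \<subseteq> B"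
    and disj: "disjoint_family_on f Z" and pos: "\<And>z. z \<in> Z \<Longrightarrow> 0 < emeasure M (f z)"
  shows "countable Z"
proof -
  have fm: "f z \<in> fmeasurable M" if "z \<in> Z" for z
    using fmeasurableI2[OF B f(2)[OF that] f(1)[OF that]] .
  have "(\<lambda>z. measure M (f z)) summable_on Z"
  proof (rule nonneg_bdd_above_summable_on)
    have "(\<Sum>z\<in>F. measure M (f z)) \<le> measure M B" if F: "F \<subseteq> Z" "finite F" for F
    proof -
      have "(\<Sum>z\<in>F. measure M (f z)) = measure M (\<Union>z\<in>F. f z)"
        using F fm disj by (intro measure_UNION'[symmetric])
          (fastforce simp: disjoint_family_on_def pairwise_def disjnt_def)+
      also have "\<dots> \<le> measure M B"
        using F f B by (intro measure_mono_fmeasurable) auto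
      finally show ?thesis .
    qed
    then show "bdd_above (sum (\<lambda>z. measure M (f z)) ` {F. F \<subseteq> Z \<and> finite F})"
      by (auto simp: bdd_above_def)
  qed simp
  then have "countable {z \<in> Z. measure M (f z) \<noteq> 0}" by (rule summable_countable_real)
  moreover have "measure M (f z) \<noteq> 0" if "z \<in> Z" for z
    using pos[OF that] fm[OF that] by (auto simp: emeasure_eq_measure2 fmeasurableD2)
  ultimately show ?thesis by (simp cong: conj_cong)
qed

text \<open>
  Balls of finite positive measure force separability: small balls around the points of a separated
  set are disjoint, and only countably many disjoint sets of positive measure fit into a ball.
\<close>

lemma countable_cover_small_diameter:
  assumes qm: "quasi_metric_measure_space M d" and \<epsilon>: "0 < \<epsilon>"
  shows "\<exists>A :: nat \<Rightarrow> 'a set. (\<forall>n. A n \<in> sets M) \<and> (\<Union>n. A n) = space M \<and>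
    (\<forall>n. \<forall>x\<in>A n. \<forall>y\<in>A n. d x y < \<epsilon>)"
proof -
  define X where "X = space M"
  have X: "quasi_metric X d" using qm by (auto simp: quasi_metric_measure_space_def X_def)
  have eq0: "\<And>x y. x \<in> X \<Longrightarrow> y \<in> X \<Longrightarrow> d x y = 0 \<longleftrightarrow> x = y"
    using X by (auto simp: quasi_metric_def)
  obtain C0 C1 where C: "1 \<le> C0" "1 \<le> C1"
    and sym: "\<forall>x\<in>X. \<forall>y\<in>X. d y x \<le> C0 * d x y"
    and tri: "\<forall>x\<in>X. \<forall>y\<in>X. \<forall>z\<in>X. d x y \<le> C1 * max (d x z) (d z y)"
    using quasi_metric_constants[OF X] by blast
  obtain x0 where x0: "x0 \<in> X"
    using qm by (auto simp: quasi_metric_measure_space_def quasi_metric_def X_def)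
  have ball: "qball X d x r \<in> sets M" "0 < emeasure M (qball X d x r)" "emeasure M (qball X d x r) < \<infinity>"
    if "x \<in> X" "0 < r" for x r
    using qm that by (auto simp: quasi_metric_measure_space_def X_def)
  have symlt: "d y x < C0 * s" if "x \<in> X" "y \<in> X" "d x y < s" for x y s
    using sym[rule_format, OF that(1,2)] that(3) C(1) mult_strict_left_mono[of "d x y" s C0]
    by linarith
  have trilt: "d x y < C1 * s" if "x \<in> X" "y \<in> X" "z \<in> X" "d x z < s" "d z y < s" for x y z s
  proof -
    have "C1 * max (d x z) (d z y) < C1 * s"
      using that(4,5) C(2) by (intro mult_strict_left_mono) auto
    then show ?thesis using tri[rule_format, OF that(1-3)] by linarith
  qed
  \<comment> \<open>Two constants \<open>C0\<close> enter \<open>\<rho>\<close>: one because maximality may give the distance in the wrong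
    order, one to compare two points of a ball through its centre.\<close>
  define \<rho> where "\<rho> = \<epsilon> / (C1 * C0 * C0)"
  define \<sigma> where "\<sigma> = \<rho> / (C1 * C0)"
  have \<rho>: "0 < \<rho>" "C1 * (C0 * (C0 * \<rho>)) = \<epsilon>" and \<sigma>: "0 < \<sigma>" "C1 * (C0 * \<sigma>) = \<rho>"
    using \<epsilon> C by (auto simp: \<rho>_def \<sigma>_def)
  obtain Z where Z: "Z \<subseteq> X" and sep: "\<forall>z\<in>Z. \<forall>w\<in>Z. z \<noteq> w \<longrightarrow> \<rho> \<le> d z w"
    and max: "\<forall>x\<in>X - Z. \<exists>z\<in>Z. d x z < \<rho> \<or> d z x < \<rho>"
    using maximal_separated_set[of X \<rho> d] by blast
  have disj: "disjoint_family_on (\<lambda>z. qball X d z \<sigma>) Z"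
  proof (rule ccontr)
    assume "\<not> disjoint_family_on (\<lambda>z. qball X d z \<sigma>) Z"
    then obtain z w x where *: "z \<in> Z" "w \<in> Z" "z \<noteq> w" "x \<in> X" "d z x < \<sigma>" "d w x < \<sigma>"
      by (auto simp: disjoint_family_on_def qball_def)
    have "\<sigma> \<le> C0 * \<sigma>" using C(1) \<sigma>(1) by simp
    then have "d z x < C0 * \<sigma>" "d x w < C0 * \<sigma>"
      using * Z symlt[of w x \<sigma>] by auto
    then have "d z w < \<rho>" using trilt[of z w x "C0 * \<sigma>"] * Z \<sigma>(2) by auto
    then show False using sep * by force
  qed
  have "countable {z \<in> Z. d x0 z < real n}" for n
  proof -
    define r where "r = C1 * max (real n) \<sigma>"
    have "0 < r" using C \<sigma>(1) by (simp add: r_def less_max_iff_disj)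
    show ?thesis
    proof (rule countable_disjoint_positive_measure[where f = "\<lambda>z. qball X d z \<sigma>"])
      show "qball X d x0 r \<in> fmeasurable M"
        using ball[OF x0 \<open>0 < r\<close>] by (simp add: fmeasurable_def)
      show "qball X d z \<sigma> \<subseteq> qball X d x0 r" if "z \<in> {z \<in> Z. d x0 z < real n}" for z
        using that Z x0 trilt[of x0 _ z "max (real n) \<sigma>"]
        by (auto simp: qball_def r_def less_max_iff_disj)
      show "disjoint_family_on (\<lambda>z. qball X d z \<sigma>) {z \<in> Z. d x0 z < real n}"
        using disj by (rule disjoint_family_on_mono[rotated]) auto
    qed (use Z ball \<sigma> in auto)
  qed
  then have "countable (\<Union>n. {z \<in> Z. d x0 z < real n})" by (intro countable_UN) auto
  moreover have "(\<Union>n. {z \<in> Z. d x0 z < real n}) = Z"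
    using reals_Archimedean2 by auto
  ultimately have "countable Z" by simp
  have "Z \<noteq> {}" using max x0 by blast
  have near: "\<exists>z\<in>Z. d z x < C0 * \<rho>" if "x \<in> X" for x
  proof -
    have "\<rho> \<le> C0 * \<rho>" using C(1) \<rho>(1) by simp
    show ?thesis
    proof (cases "x \<in> Z")
      case True
      then show ?thesis using eq0[OF that that] C \<rho>(1) by (intro bexI[of _ x]) (auto simp: mult_pos_pos)
    next
      case False
      then obtain z where z: "z \<in> Z" "d x z < \<rho> \<or> d z x < \<rho>"
        using max \<open>x \<in> X\<close> by blast
      then have "z \<in> X" using Z by blast
      then have "d z x < C0 * \<rho>"
        using symlt[OF that, of z \<rho>] z(2) \<open>\<rho> \<le> C0 * \<rho>\<close> by linarith
      then show ?thesis using z(1) by blast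
    qed
  qed
  define A where "A n = qball X d (from_nat_into Z n) (C0 * \<rho>)" for n
  have fnZ: "from_nat_into Z n \<in> Z" for n using \<open>Z \<noteq> {}\<close> by (rule from_nat_into)
  have "0 < C0 * \<rho>" using C \<rho> by auto
  show ?thesis
  proof (intro exI[of _ A] conjI allI ballI)
    show "A n \<in> sets M" for n
      unfolding A_def using fnZ Z ball \<open>0 < C0 * \<rho>\<close> by blast
    have "x \<in> (\<Union>n. A n)" if x: "x \<in> X" for x
    proof -
      obtain z where z: "z \<in> Z" "d z x < C0 * \<rho>" using near[OF x] by blast
      then obtain n where "from_nat_into Z n = z"
        using from_nat_into_surj[OF \<open>countable Z\<close>] by blast
      then show ?thesis using z x by (auto simp: A_def qball_def)
    qed
    moreover have "A n \<subseteq> X" for n by (auto simp: A_def qball_def)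
    ultimately show "(\<Union>n. A n) = space M" by (auto simp: X_def)
    fix n x y assume xy: "x \<in> A n" "y \<in> A n"
    define z where "z = from_nat_into Z n"
    have *: "x \<in> X" "y \<in> X" "z \<in> X" "d z x < C0 * \<rho>" "d z y < C0 * \<rho>"
      using xy fnZ[of n] Z by (auto simp: A_def qball_def z_def)
    have "C0 * \<rho> \<le> C0 * (C0 * \<rho>)" using C \<rho>(1) by simp
    then show "d x y < \<epsilon>"
      using trilt[of x y z "C0 * (C0 * \<rho>)"] symlt[of z x "C0 * \<rho>"] * \<rho>(2) by auto
  qed
qed

text \<open>
  Outside an exceptional set, each function is bounded by \<open>L\<close> and almost constant on finitely many
  cells, so it is described up to a small error by one integer of bounded size for each cell. There
  are finitely many such descriptions, and functions with the same one are close in measure.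
\<close>

lemma finite_net_in_measure:
  fixes S :: "('a \<Rightarrow> real) set" and A :: "nat \<Rightarrow> 'a set"
  assumes l: "0 < e" and A: "\<And>j. A j \<subseteq> space N"
    and S: "\<And>u. u \<in> S \<Longrightarrow> \<exists>B\<in>sets N. emeasure N B \<le> \<delta> \<and>
        (\<forall>x\<in>space N - B. \<bar>u x\<bar> \<le> L \<and> (\<exists>j<J. x \<in> A j)) \<and>
        (\<forall>j<J. \<forall>x\<in>A j - B. \<forall>y\<in>A j - B. \<bar>u x - u y\<bar> \<le> e)"
  shows "\<exists>F. finite F \<and> F \<subseteq> S \<and> (\<forall>u\<in>S. \<exists>f\<in>F. \<exists>B\<in>sets N. emeasure N B \<le> 2 * \<delta> \<and>
        (\<forall>x\<in>space N - B. \<bar>u x - f x\<bar> \<le> 3 * e))"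
proof -
  have "\<forall>u\<in>S. \<exists>B. B \<in> sets N \<and> emeasure N B \<le> \<delta> \<and>
      (\<forall>x\<in>space N - B. \<bar>u x\<bar> \<le> L \<and> (\<exists>j<J. x \<in> A j)) \<and>
      (\<forall>j<J. \<forall>x\<in>A j - B. \<forall>y\<in>A j - B. \<bar>u x - u y\<bar> \<le> e)"
    using S by blast
  from bchoice[OF this] obtain bad where b: "\<forall>u\<in>S. bad u \<in> sets N \<and> emeasure N (bad u) \<le> \<delta> \<and>
      (\<forall>x\<in>space N - bad u. \<bar>u x\<bar> \<le> L \<and> (\<exists>j<J. x \<in> A j)) \<and>
      (\<forall>j<J. \<forall>x\<in>A j - bad u. \<forall>y\<in>A j - bad u. \<bar>u x - u y\<bar> \<le> e)" ..
  have bad: "bad u \<in> sets N" "emeasure N (bad u) \<le> \<delta>"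
    "\<forall>x\<in>space N - bad u. \<bar>u x\<bar> \<le> L \<and> (\<exists>j<J. x \<in> A j)"
    "\<forall>j<J. \<forall>x\<in>A j - bad u. \<forall>y\<in>A j - bad u. \<bar>u x - u y\<bar> \<le> e"
    if "u \<in> S" for u
    using bspec[OF b that] by blast+
  define pt where "pt u j = (SOME x. x \<in> A j - bad u)" for u j
  \<comment> \<open>The value 0 on a cell inside the exceptional set only keeps the range of patterns finite.\<close>
  define pat where "pat u = (\<lambda>j\<in>{..<J}. if A j - bad u = {} then 0 else \<lfloor>u (pt u j) / e\<rfloor>)" for u
  have pt: "pt u j \<in> A j - bad u" if "A j - bad u \<noteq> {}" for u j
    unfolding pt_def some_in_eq by (rule that)
  have "pat u \<in> {..<J} \<rightarrow>\<^sub>E {\<lfloor>- (\<bar>L\<bar> / e)\<rfloor>..\<lfloor>\<bar>L\<bar> / e\<rfloor>}" if u: "u \<in> S" for u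
    unfolding pat_def restrict_PiE_iff
  proof
    fix j assume "j \<in> {..<J}"
    show "(if A j - bad u = {} then 0 else \<lfloor>u (pt u j) / e\<rfloor>) \<in> {\<lfloor>- (\<bar>L\<bar> / e)\<rfloor>..\<lfloor>\<bar>L\<bar> / e\<rfloor>}"
    proof (cases "A j - bad u = {}")
      case True
      have "0 \<le> \<bar>L\<bar> / e" using l by simp
      then have "\<lfloor>- (\<bar>L\<bar> / e)\<rfloor> \<le> 0" "0 \<le> \<lfloor>\<bar>L\<bar> / e\<rfloor>" by linarith+
      then show ?thesis using True by simp
    next
      case False
      then have "pt u j \<in> space N - bad u" using pt[OF False] A by blast
      then have "\<bar>u (pt u j)\<bar> \<le> \<bar>L\<bar>" using bspec[OF bad(3)[OF u]] by force
      then have "- (\<bar>L\<bar> / e) \<le> u (pt u j) / e" "u (pt u j) / e \<le> \<bar>L\<bar> / e"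
        using l by (auto simp: field_simps abs_le_iff)
      then show ?thesis using False by (auto intro: floor_mono)
    qed
  qed
  then have "pat ` S \<subseteq> {..<J} \<rightarrow>\<^sub>E {\<lfloor>- (\<bar>L\<bar> / e)\<rfloor>..\<lfloor>\<bar>L\<bar> / e\<rfloor>}" by blast
  then have fin: "finite (pat ` S)" by (rule finite_subset) (auto intro: finite_PiE)
  have "\<exists>F\<subseteq>S. finite F \<and> pat ` S = pat ` F" by (rule finite_subset_image[OF fin order_refl])
  then obtain F where "F \<subseteq> S \<and> finite F \<and> pat ` S = pat ` F" ..
  then have F: "finite F" "F \<subseteq> S" "pat ` F = pat ` S" by simp_all
  have "\<exists>f\<in>F. \<exists>B\<in>sets N. emeasure N B \<le> 2 * \<delta> \<and> (\<forall>x\<in>space N - B. \<bar>u x - f x\<bar> \<le> 3 * e)"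
    if u: "u \<in> S" for u
  proof -
    have "pat u \<in> pat ` F" using u F(3) by simp
    then obtain f where f: "f \<in> F" "f \<in> S" "pat f = pat u" using F(2) by auto
    have "emeasure N (bad u \<union> bad f) \<le> emeasure N (bad u) + emeasure N (bad f)"
      using u f bad by (intro emeasure_subadditive)
    also have "\<dots> \<le> 2 * \<delta>" unfolding mult_2 using u f bad by (intro add_mono)
    finally have meas: "emeasure N (bad u \<union> bad f) \<le> 2 * \<delta>" .
    have "\<bar>u x - f x\<bar> \<le> 3 * e" if x: "x \<in> space N - (bad u \<union> bad f)" for x
    proof -
      obtain j where j: "j < J" "x \<in> A j" using bad(3)[OF u] x by blast
      have ne: "A j - bad u \<noteq> {}" "A j - bad f \<noteq> {}" using j x by auto
      have "pat u j = \<lfloor>u (pt u j) / e\<rfloor>" "pat f j = \<lfloor>f (pt f j) / e\<rfloor>"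
        using ne j(1) by (auto simp: pat_def)
      then have "\<lfloor>u (pt u j) / e\<rfloor> = \<lfloor>f (pt f j) / e\<rfloor>" using f(3) by simp
      then have "\<bar>u (pt u j) / e - f (pt f j) / e\<bar> \<le> 1" by linarith
      then have "\<bar>u (pt u j) - f (pt f j)\<bar> \<le> e"
        using l by (simp add: abs_le_iff field_simps)
      moreover have "\<bar>u x - u (pt u j)\<bar> \<le> e" "\<bar>f x - f (pt f j)\<bar> \<le> e"
        using bad(4)[OF u, rule_format, OF j(1), of x "pt u j"]
          bad(4)[OF f(2), rule_format, OF j(1), of x "pt f j"] pt[OF ne(1)] pt[OF ne(2)] x j by auto
      ultimately show ?thesis by linarith
    qed
    then show ?thesis using f(1) meas u f(2) bad(1) by (intro bexI[of _ f] bexI[of _ "bad u \<union> bad f"]) auto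
  qed
  then show ?thesis using F by blast
qed

text \<open>
  On a space of finite measure, boundedness in a higher Lebesgue space makes the lower powers
  uniformly integrable, so closeness in measure is closeness in norm.
\<close>

lemma finite_net_in_Lp:
  fixes S :: "('a \<Rightarrow> real) set"
  assumes N: "finite_measure N" and p: "0 < p'" "p' < p" and R: "0 \<le> R"
    and S: "\<And>u. u \<in> S \<Longrightarrow> u \<in> borel_measurable N" "\<And>u. u \<in> S \<Longrightarrow> Lp_fun_norm N p u \<le> ennreal R"
    and net: "\<And>e \<delta>. 0 < e \<Longrightarrow> 0 < \<delta> \<Longrightarrow> \<exists>F. finite F \<and> F \<subseteq> S \<and>
      (\<forall>u\<in>S. \<exists>f\<in>F. \<exists>B\<in>sets N. emeasure N B \<le> ennreal \<delta> \<and> (\<forall>x\<in>space N - B. \<bar>u x - f x\<bar> \<le> e))"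
    and \<epsilon>: "0 < \<epsilon>"
  shows "\<exists>F. finite F \<and> F \<subseteq> S \<and> (\<forall>u\<in>S. \<exists>f\<in>F. Lp_fun_norm N p' (\<lambda>x. u x - f x) \<le> ennreal \<epsilon>)"
proof -
  interpret finite_measure N by fact
  define V where "V = measure N (space N)"
  have V: "emeasure N (space N) = ennreal V" "0 \<le> V"
    by (simp_all add: V_def emeasure_eq_measure)
  define t where "t = \<epsilon> powr p' / 3"
  have t: "0 < t" "3 * t = \<epsilon> powr p'" using \<epsilon> by (auto simp: t_def)
  define W where "W = 2 powr (1 + 1 / p) * R"
  have W: "0 \<le> W" using R by (simp add: W_def)
  \<comment> \<open>The threshold \<open>s\<close> makes the part of the integral with the higher power at most \<open>t\<close>, the
    measure \<open>\<delta>\<close> of the exceptional set does this for the values below \<open>s\<close> on that set, and \<open>e\<close> for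
    its complement.\<close>
  define s where "s = ((W powr p + 1) / t) powr (1 / (p - p'))"
  define \<delta> where "\<delta> = t / s powr p'"
  define e where "e = (t / (V + 1)) powr (1 / p')"
  have Wp: "0 < W powr p + 1" by (simp add: add_nonneg_pos)
  have s: "0 < s" using Wp t(1) by (simp add: s_def)
  then have \<delta>: "0 < \<delta>" using t(1) by (simp add: \<delta>_def)
  have e: "0 < e" using t(1) V(2) by (auto simp: e_def)
  have e1: "e powr p' * V \<le> t"
  proof -
    have "e powr p' * V \<le> e powr p' * (V + 1)" by (intro mult_left_mono) auto
    moreover have "e powr p' = t / (V + 1)" using p t(1) V(2) by (simp add: e_def powr_powr)
    then have "e powr p' * (V + 1) = t" using V(2) by simp
    ultimately show ?thesis by simp
  qed
  have s1: "s powr (p' - p) * W powr p \<le> t"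
  proof -
    have "s powr (p' - p) * W powr p \<le> s powr (p' - p) * (W powr p + 1)"
      by (intro mult_left_mono) auto
    moreover have "(1 / (p - p')) * (p' - p) = -1" using p by (simp add: field_simps)
    then have "s powr (p' - p) = ((W powr p + 1) / t) powr (-1)"
      by (simp only: s_def powr_powr)
    then have "s powr (p' - p) = t / (W powr p + 1)"
      using Wp t(1) by (simp add: powr_minus_divide)
    then have "s powr (p' - p) * (W powr p + 1) = t" using Wp by simp
    ultimately show ?thesis by simp
  qed
  have d1: "s powr p' * \<delta> = t" using s by (simp add: \<delta>_def)
  obtain F where F: "finite F" "F \<subseteq> S"
    and cl: "\<forall>u\<in>S. \<exists>f\<in>F. \<exists>B\<in>sets N. emeasure N B \<le> ennreal \<delta> \<and> (\<forall>x\<in>space N - B. \<bar>u x - f x\<bar> \<le> e)"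
    using net[OF e \<delta>] by blast
  have "\<exists>f\<in>F. Lp_fun_norm N p' (\<lambda>x. u x - f x) \<le> ennreal \<epsilon>" if u: "u \<in> S" for u
  proof -
    obtain f B where f: "f \<in> F" and B [measurable]: "B \<in> sets N" and mB: "emeasure N B \<le> ennreal \<delta>"
      and near: "\<forall>x\<in>space N - B. \<bar>u x - f x\<bar> \<le> e"
      using cl u by blast
    have fS: "f \<in> S" using f F by blast
    note [measurable] = S(1)[OF u] S(1)[OF fS]
    have "Lp_norm N p (\<lambda>x. ennreal \<bar>u x - f x\<bar>) \<le> Lp_norm N p (\<lambda>x. ennreal \<bar>u x\<bar> + ennreal \<bar>f x\<bar>)"
      using p by (intro Lp_norm_mono) (auto simp flip: ennreal_plus intro!: ennreal_leI)
    also have "\<dots> \<le> ennreal (2 powr (1 + 1 / p)) *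
        max (Lp_norm N p (\<lambda>x. ennreal \<bar>u x\<bar>)) (Lp_norm N p (\<lambda>x. ennreal \<bar>f x\<bar>))"
      using p by (intro Lp_norm_add_le) auto
    also have "\<dots> \<le> ennreal (2 powr (1 + 1 / p)) * ennreal R"
      using S(2)[OF u] S(2)[OF fS] by (intro mult_left_mono) (auto simp: Lp_fun_norm_def)
    also have "\<dots> = ennreal W" using R by (simp add: W_def ennreal_mult)
    finally have "(\<integral>\<^sup>+ x. epowr (ennreal \<bar>u x - f x\<bar>) p \<partial>N) \<le> ennreal (W powr p)"
      using p W by (simp add: Lp_norm_le_iff epowr_ennreal)
    then have "ennreal (s powr (p' - p)) * (\<integral>\<^sup>+ x. epowr (ennreal \<bar>u x - f x\<bar>) p \<partial>N)
        \<le> ennreal (s powr (p' - p)) * ennreal (W powr p)"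
      by (intro mult_left_mono) auto
    also have "\<dots> \<le> ennreal t"
      using s1 by (simp add: ennreal_leI flip: ennreal_mult)
    finally have high: "ennreal (s powr (p' - p)) * (\<integral>\<^sup>+ x. epowr (ennreal \<bar>u x - f x\<bar>) p \<partial>N)
        \<le> ennreal t" .
    have "(\<integral>\<^sup>+ x. epowr (ennreal \<bar>u x - f x\<bar>) p' \<partial>N)
        \<le> (\<integral>\<^sup>+ x. ennreal (e powr p') + (ennreal (s powr p') * indicator B x
            + ennreal (s powr (p' - p)) * epowr (ennreal \<bar>u x - f x\<bar>) p) \<partial>N)"
    proof (rule nn_integral_mono)
      fix x assume x: "x \<in> space N"
      show "epowr (ennreal \<bar>u x - f x\<bar>) p' \<le> ennreal (e powr p') + (ennreal (s powr p') * indicator B x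
            + ennreal (s powr (p' - p)) * epowr (ennreal \<bar>u x - f x\<bar>) p)"
      proof (cases "x \<in> B")
        case True
        then show ?thesis
          using epowr_le_split[of p' p s "ennreal \<bar>u x - f x\<bar>"] p s by (simp add: add_increasing)
      next
        case False
        then have "\<bar>u x - f x\<bar> powr p' \<le> e powr p'" using near x p by (intro powr_mono2) auto
        then show ?thesis
          using False by (simp add: epowr_ennreal ennreal_leI add_increasing2)
      qed
    qed
    also have "\<dots> = ennreal (e powr p') * ennreal V + (ennreal (s powr p') * emeasure N B
        + ennreal (s powr (p' - p)) * (\<integral>\<^sup>+ x. epowr (ennreal \<bar>u x - f x\<bar>) p \<partial>N))"
      by (simp add: nn_integral_add nn_integral_cmult nn_integral_cmult_indicator V)
    also have "\<dots> \<le> ennreal t + (ennreal (s powr p') * ennreal \<delta> + ennreal t)"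
      using e1 V(2) by (intro add_mono high mult_left_mono mB) (auto simp: ennreal_leI simp flip: ennreal_mult)
    also have "\<dots> = ennreal (3 * t)"
      using t(1) \<delta> d1 by (simp flip: ennreal_mult ennreal_plus)
    also have "\<dots> = epowr (ennreal \<epsilon>) p'"
      using \<epsilon> t(2) by (simp add: epowr_ennreal)
    finally have "Lp_fun_norm N p' (\<lambda>x. u x - f x) \<le> ennreal \<epsilon>"
      using p by (simp add: Lp_fun_norm_def Lp_norm_le_iff)
    then show ?thesis using f by blast
  qed
  then show ?thesis using F by blast
qed

text \<open>
  At small scales the Hajlasz inequality says that \<open>u\<close> is almost constant on sets of small diameter,
  off the set where the small function \<open>tail_sup\<close> is large; Chebyshev's inequality bounds that set
  uniformly in the family.
\<close>

lemma hajlasz_family_finite_net: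
  fixes S :: "('a \<Rightarrow> real) set"
  assumes qm: "quasi_metric_measure_space M d" and N: "finite_measure N" "sets N = sets M"
    and \<alpha>: "0 < \<alpha>" and p: "0 < p'" "p' < p" and R: "0 \<le> R"
    and S: "\<And>u. u \<in> S \<Longrightarrow> u \<in> borel_measurable N" "\<And>u. u \<in> S \<Longrightarrow> Lp_fun_norm N p u \<le> ennreal R"
      "\<And>u. u \<in> S \<Longrightarrow> \<exists>g\<in>hajlasz_grads d N \<alpha> u. \<forall>k. Lp_norm N p (g k) \<le> ennreal R"
    and \<epsilon>: "0 < \<epsilon>"
  shows "\<exists>F. finite F \<and> F \<subseteq> S \<and> (\<forall>u\<in>S. \<exists>f\<in>F. Lp_fun_norm N p' (\<lambda>x. u x - f x) \<le> ennreal \<epsilon>)"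
proof (rule finite_net_in_Lp[OF N(1) p R S(1,2) _ \<epsilon>])
  interpret finite_measure N by fact
  have sp: "space N = space M" using N(2) by (rule sets_eq_imp_space_eq)
  have p0: "0 < p" using p by simp
  fix e \<delta> :: real assume e: "0 < e" and \<delta>: "0 < \<delta>"
  define \<tau> where "\<tau> = \<delta> / 6"
  have \<tau>: "0 < \<tau>" using \<delta> by (simp add: \<tau>_def)
  define l where "l = e / 6"
  have l: "0 < l" using e by (simp add: l_def)
  define L where "L = R / \<tau> powr (1 / p) + 1"
  have L: "0 < L" using R by (simp add: L_def add_nonneg_pos)
  have RL: "(R / L) powr p \<le> \<tau>"
  proof -
    have "R \<le> \<tau> powr (1 / p) * L" using \<tau> by (simp add: L_def field_simps)
    then have "R / L \<le> \<tau> powr (1 / p)" using L by (simp add: field_simps)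
    then have "(R / L) powr p \<le> (\<tau> powr (1 / p)) powr p" using R L p0 by (intro powr_mono2) auto
    then show ?thesis using p0 \<tau> by (simp add: powr_powr)
  qed
  from Lp_norm_tail_sup[OF \<alpha> p0, of N]
  obtain A where "0 < A" and A: "\<forall>g R K. (\<forall>k. g k \<in> borel_measurable N) \<longrightarrow>
      (\<forall>k. Lp_norm N p (g k) \<le> R) \<longrightarrow>
      Lp_norm N p (tail_sup \<alpha> K g) \<le> ennreal (A * 2 powr (- \<alpha> * real K)) * R"
    by blast
  have "(\<lambda>K. (2 powr - \<alpha>) ^ K) \<longlonglongrightarrow> 0"
    using \<alpha> by (intro LIMSEQ_realpow_zero) (auto simp: powr_less_one)
  from tendsto_mult_right_zero[OF this]
  have "(\<lambda>K. A * R * (2 powr - \<alpha>) ^ K) \<longlonglongrightarrow> 0" .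
  then have "\<forall>\<^sub>F K in sequentially. A * R * (2 powr - \<alpha>) ^ K < l * \<tau> powr (1 / p)"
    using l \<tau> by (intro order_tendstoD(2)) auto
  from eventually_happens'[OF sequentially_bot this]
  obtain K :: nat where "A * R * (2 powr - \<alpha>) ^ K < l * \<tau> powr (1 / p)"
    by blast
  then have K: "A * 2 powr (- \<alpha> * real K) * R \<le> l * \<tau> powr (1 / p)"
    by (simp add: powr_powr mult_ac flip: powr_realpow)
  define w where "w = A * 2 powr (- \<alpha> * real K) * R"
  have "0 \<le> w" using \<open>0 < A\<close> R by (simp add: w_def)
  have wl: "(w / l) powr p \<le> \<tau>"
  proof -
    have "w / l \<le> \<tau> powr (1 / p)" using K l by (simp add: w_def field_simps)
    then have "(w / l) powr p \<le> (\<tau> powr (1 / p)) powr p" using \<open>0 \<le> w\<close> l p0 by (intro powr_mono2) auto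
    then show ?thesis using p0 \<tau> by (simp add: powr_powr)
  qed
  have "0 < (2 :: real) powi (- int K)" by simp
  from countable_cover_small_diameter[OF qm this]
  obtain C :: "nat \<Rightarrow> 'a set" where C: "\<forall>n. C n \<in> sets M" "(\<Union>n. C n) = space M"
    "\<forall>n. \<forall>x\<in>C n. \<forall>y\<in>C n. d x y < 2 powi (- int K)"
    by blast
  have CN [measurable]: "C n \<in> sets N" for n using C(1) N(2) by simp
  have "(\<lambda>J. emeasure N (space N - (\<Union>j<J. C j))) \<longlonglongrightarrow> emeasure N (\<Inter>J. space N - (\<Union>j<J. C j))"
    by (intro Lim_emeasure_decseq) (fastforce simp: decseq_def)+
  moreover have "(\<Inter>J. space N - (\<Union>j<J. C j)) = {}"
  proof -
    have "space N \<subseteq> (\<Union>J. \<Union>j<J. C j)"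
      unfolding sp C(2)[symmetric] by blast
    then show ?thesis by blast
  qed
  ultimately have "(\<lambda>J. emeasure N (space N - (\<Union>j<J. C j))) \<longlonglongrightarrow> 0"
    by (simp only: emeasure_empty)
  then have "\<forall>\<^sub>F J in sequentially. emeasure N (space N - (\<Union>j<J. C j)) < ennreal \<tau>"
    using \<tau> by (intro order_tendstoD(2)) auto
  from eventually_happens'[OF sequentially_bot this]
  obtain J where J: "emeasure N (space N - (\<Union>j<J. C j)) < ennreal \<tau>"
    by blast
  have cells: "\<exists>B\<in>sets N. emeasure N B \<le> ennreal (3 * \<tau>) \<and>
      (\<forall>x\<in>space N - B. \<bar>u x\<bar> \<le> L \<and> (\<exists>j<J. x \<in> C j)) \<and>
      (\<forall>j<J. \<forall>x\<in>C j - B. \<forall>y\<in>C j - B. \<bar>u x - u y\<bar> \<le> 2 * l)" if u: "u \<in> S" for u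
  proof -
    note [measurable] = S(1)[OF u]
    obtain g where g: "g \<in> hajlasz_grads d N \<alpha> u" "\<forall>k. Lp_norm N p (g k) \<le> ennreal R"
      using S(3)[OF u] by blast
    note gm = hajlasz_grads_measurable[OF g(1)]
    obtain E where E: "E \<in> null_sets N"
      "\<forall>k. \<forall>x\<in>space N - E. \<forall>y\<in>space N - E. 2 powi (- k - 1) \<le> d x y \<and> d x y < 2 powi (- k) \<longrightarrow>
        ennreal \<bar>u x - u y\<bar> \<le> ennreal (d x y powr \<alpha>) * (g k x + g k y)"
      using g(1) unfolding hajlasz_grads_def by blast
    define G where "G = tail_sup \<alpha> K g"
    have [measurable]: "G \<in> borel_measurable N"
      unfolding G_def using gm by (intro borel_measurable_tail_sup)
    have [measurable]: "E \<in> sets N" using E(1) by auto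
    have "Lp_norm N p G \<le> ennreal (A * 2 powr (- \<alpha> * real K)) * ennreal R"
      unfolding G_def using A gm g(2) by blast
    also have "\<dots> = ennreal w" using \<open>0 < A\<close> R by (simp add: w_def ennreal_mult)
    finally have "Lp_norm N p G \<le> ennreal w" .
    then have "emeasure N {x \<in> space N. ennreal l < G x} \<le> ennreal ((w / l) powr p)"
      using p0 l \<open>0 \<le> w\<close> by (intro emeasure_gt_le_Lp_norm) auto
    also have "\<dots> \<le> ennreal \<tau>" by (intro ennreal_leI wl)
    finally have B1: "emeasure N {x \<in> space N. ennreal l < G x} \<le> ennreal \<tau>" .
    have "emeasure N {x \<in> space N. ennreal L < ennreal \<bar>u x\<bar>} \<le> ennreal ((R / L) powr p)"
      using p0 L R S(2)[OF u] by (intro emeasure_gt_le_Lp_norm) (auto simp: Lp_fun_norm_def)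
    also have "\<dots> \<le> ennreal \<tau>" by (intro ennreal_leI RL)
    finally have B2: "emeasure N {x \<in> space N. ennreal L < ennreal \<bar>u x\<bar>} \<le> ennreal \<tau>" .
    define B where "B = ({x \<in> space N. ennreal l < G x} \<union> {x \<in> space N. ennreal L < ennreal \<bar>u x\<bar>})
      \<union> (space N - (\<Union>j<J. C j)) \<union> E"
    have "emeasure N B \<le> emeasure N ({x \<in> space N. ennreal l < G x} \<union> {x \<in> space N. ennreal L < ennreal \<bar>u x\<bar>})
        + emeasure N (space N - (\<Union>j<J. C j)) + emeasure N E"
      unfolding B_def by (intro order_trans[OF emeasure_subadditive] add_mono emeasure_subadditive) auto
    also have "\<dots> \<le> (ennreal \<tau> + ennreal \<tau>) + ennreal \<tau> + 0"
      using J E(1) by (intro add_mono order_trans[OF emeasure_subadditive] B1 B2) (auto simp: null_sets_def)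
    also have "\<dots> = ennreal (3 * \<tau>)" using \<tau> by (simp flip: ennreal_plus)
    finally have mB: "emeasure N B \<le> ennreal (3 * \<tau>)" .
    have BN: "B \<in> sets N" unfolding B_def by measurable
    have bd: "\<bar>u x\<bar> \<le> L \<and> (\<exists>j<J. x \<in> C j)" if x: "x \<in> space N - B" for x
      using x L by (auto simp: B_def not_less)
    have osc: "\<bar>u x - u y\<bar> \<le> 2 * l" if x: "x \<in> C j - B" and y: "y \<in> C j - B" for j x y
    proof (cases "x = y")
      case True
      then show ?thesis using l by simp
    next
      case False
      have xy: "x \<in> space M" "y \<in> space M" using x y C(1) sets.sets_into_space by blast+
      then have G: "G x \<le> ennreal l" "G y \<le> ennreal l" "x \<in> space N - E" "y \<in> space N - E"
        using x y by (auto simp: B_def sp not_less)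
      have "0 < d x y"
        using False xy qm unfolding quasi_metric_measure_space_def quasi_metric_def
        by (metis order_le_less)
      define k where "k = - \<lfloor>log 2 (d x y)\<rfloor> - 1"
      have "2 powr \<lfloor>log 2 (d x y)\<rfloor> \<le> d x y" "d x y < 2 powr real_of_int (\<lfloor>log 2 (d x y)\<rfloor> + 1)"
        using floor_log_eq_powr_iff[of "d x y" 2 "\<lfloor>log 2 (d x y)\<rfloor>"] \<open>0 < d x y\<close> by auto
      then have sh: "2 powi (- k - 1) \<le> d x y \<and> d x y < 2 powi (- k)"
        using powr_real_of_int'[of 2 "\<lfloor>log 2 (d x y)\<rfloor>"] powr_real_of_int'[of 2 "\<lfloor>log 2 (d x y)\<rfloor> + 1"]
        by (simp add: k_def add.commute)
      have "2 powi (- k - 1) < (2 :: real) powi (- int K)"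
        using sh C(3) x y by (auto intro: le_less_trans)
      then have "\<not> - int K \<le> - k - 1"
        using power_int_increasing[of "- int K" "- k - 1" "2 :: real"] by linarith
      then have kK: "int K \<le> k" by simp
      have wt: "ennreal (2 powr (- \<alpha> * k)) * g k z \<le> G z" for z
        unfolding G_def by (rule le_tail_sup[OF kK])
      have "ennreal \<bar>u x - u y\<bar> \<le> ennreal (d x y powr \<alpha>) * (g k x + g k y)"
        using E(2) G(3,4) sh by blast
      also have "\<dots> \<le> ennreal (2 powr (- \<alpha> * k)) * (g k x + g k y)"
        using dyadic_shell_powr(2)[OF sh, of \<alpha>] \<alpha> by (intro mult_right_mono ennreal_leI) auto
      also have "\<dots> \<le> G x + G y"
        unfolding distrib_left by (intro add_mono wt)
      also have "\<dots> \<le> ennreal l + ennreal l" by (intro add_mono G)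
      also have "\<dots> = ennreal (2 * l)" using l by (simp flip: ennreal_plus)
      finally show ?thesis using l by simp
    qed
    show ?thesis using BN mB bd osc by blast
  qed
  have "0 < 2 * l" using l by simp
  from finite_net_in_measure[OF this sets.sets_into_space[OF CN] cells]
  have "\<exists>F. finite F \<and> F \<subseteq> S \<and> (\<forall>u\<in>S. \<exists>f\<in>F. \<exists>B\<in>sets N. emeasure N B \<le> 2 * ennreal (3 * \<tau>) \<and>
        (\<forall>x\<in>space N - B. \<bar>u x - f x\<bar> \<le> 3 * (2 * l)))" by blast
  moreover have "2 * ennreal (3 * \<tau>) = ennreal \<delta>"
    using \<tau> by (simp add: \<tau>_def flip: ennreal_mult ennreal_numeral)
  ultimately show "\<exists>F. finite F \<and> F \<subseteq> S \<and>
      (\<forall>u\<in>S. \<exists>f\<in>F. \<exists>B\<in>sets N. emeasure N B \<le> ennreal \<delta> \<and> (\<forall>x\<in>space N - B. \<bar>u x - f x\<bar> \<le> e))"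
    by (simp add: l_def)
qed

section \<open>Compactness of the embeddings\<close>

lemma ennreal_mult_le_of_less:
  fixes a b :: ennreal
  assumes "0 < D" and "\<And>s. b < ennreal s \<Longrightarrow> 0 < s \<Longrightarrow> a \<le> ennreal D * ennreal s"
  shows "a \<le> ennreal D * b"
proof (cases b)
  case (real b')
  show ?thesis
  proof (rule ennreal_le_epsilon)
    fix e :: real assume e: "0 < e"
    have "a \<le> ennreal D * ennreal (b' + e / D)"
      using assms(1) real e by (intro assms(2)) (auto simp: ennreal_less_iff add_nonneg_pos)
    also have "\<dots> = ennreal D * b + ennreal e"
      using assms(1) real e by (simp add: field_simps flip: ennreal_mult ennreal_plus)
    finally show "a \<le> ennreal D * b + ennreal e" .
  qed
next
  case top
  then show ?thesis using assms(1) by (simp add: ennreal_mult_top)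
qed

text \<open>
  The source enters only through \<open>control\<close> and the target only through \<open>interpolation\<close>, so the four
  embeddings are treated together. Boundedness is the interpolation inequality with \<open>\<eta> = 1\<close>. For
  total boundedness it is applied to the differences \<open>u - f\<close> with \<open>f\<close> in a finite net for the
  Lebesgue norm: their gradients stay bounded, hence contribute little for small \<open>\<eta>\<close>, and their
  Lebesgue norm is small.
\<close>

lemma controlled_embedding_compact:
  fixes M N :: "'a measure"
  assumes qm: "quasi_metric_measure_space M d" and N: "finite_measure N" "sets N = sets M"
    and C: "0 < C" "\<And>E. E \<in> sets M \<Longrightarrow> emeasure N E \<le> ennreal C * emeasure M E"
    and \<alpha>: "0 < \<beta>" "\<beta> < \<alpha>" and p: "0 < p'" "p' < p" and q: "0 < q" "0 < r"
    and A: "A = HTL_space d M \<alpha> p q \<or> A = HB_space d M \<alpha> p q"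
    and B: "B = HTL_space d N \<beta> p' r \<or> B = HB_space d N \<beta> p' r"
  shows "compact_embedding A B"
proof -
  have pos: "0 < p" "0 < \<alpha>" "p' \<le> p" using p \<alpha> by auto
  have bm: "borel_measurable N = borel_measurable M"
    using N(2) by (intro measurable_cong_sets) auto
  define c where "c = C powr (1 / p)"
  have c: "0 < c" using C(1) by (simp add: c_def)
  have A_meas: "u \<in> borel_measurable N" and A_fin: "fs_norm A u < \<infinity>" if "u \<in> fs_elems A" for u
    using that A by (auto simp: HTL_space_def HB_space_def bm)
  have B_elems: "u \<in> fs_elems B \<longleftrightarrow> u \<in> borel_measurable N \<and> Lp_fun_norm N p' u < \<infinity> \<and> fs_norm B u < \<infinity>" for u
    using B by (auto simp: HTL_space_def HB_space_def)
  have Lp_dom: "Lp_norm N p f \<le> ennreal c * Lp_norm M p f" if "f \<in> borel_measurable M" for f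
    unfolding c_def using N(2) C pos that by (intro Lp_norm_dominated_measure) auto
  have control: "Lp_fun_norm N p u \<le> ennreal (c * s) \<and>
      (\<exists>g\<in>hajlasz_grads d N \<alpha> u. \<forall>k. Lp_norm N p (g k) \<le> ennreal (c * s))"
    if u: "u \<in> fs_elems A" and s: "fs_norm A u < ennreal s" for u s
  proof -
    have [measurable]: "u \<in> borel_measurable M" using A_meas[OF u] by (simp add: bm)
    have le: "ennreal c * x \<le> ennreal (c * s)" if "x \<le> ennreal s" for x
      using c mult_left_mono[OF that, of "ennreal c"] by (simp add: ennreal_mult')
    have "Lp_fun_norm M p u \<le> fs_norm A u"
      using A Lp_fun_norm_le_HTL_HB_norm[of M p u d \<alpha> q] by (auto simp: HTL_space_def HB_space_def)
    then have "Lp_norm M p (\<lambda>x. ennreal \<bar>u x\<bar>) \<le> ennreal s" using s by (simp add: Lp_fun_norm_def)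
    then have "Lp_fun_norm N p u \<le> ennreal (c * s)"
      using Lp_dom[of "\<lambda>x. ennreal \<bar>u x\<bar>"] le unfolding Lp_fun_norm_def by (auto intro: order_trans)
    moreover have "\<exists>g\<in>hajlasz_grads d M \<alpha> u. \<forall>k. Lp_norm M p (g k) \<le> ennreal s"
      using A
    proof
      assume "A = HTL_space d M \<alpha> p q"
      then show ?thesis
        using s by (intro HTL_norm_controls_grads[OF pos(1) q(1)]) (simp add: HTL_space_def)
    next
      assume "A = HB_space d M \<alpha> p q"
      then show ?thesis
        using s by (intro HB_norm_controls_grads[OF q(1)]) (simp add: HB_space_def)
    qed
    then obtain g where g: "g \<in> hajlasz_grads d M \<alpha> u" "\<forall>k. Lp_norm M p (g k) \<le> ennreal s" by blast
    have "Lp_norm N p (g k) \<le> ennreal (c * s)" for k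
      using Lp_dom[OF hajlasz_grads_measurable[OF g(1)]] le g(2) by (blast intro: order_trans)
    moreover have "g \<in> hajlasz_grads d N \<alpha> u"
      using N(2) C(2) g(1) by (intro hajlasz_grads_dominated_measure[of N M C])
    ultimately show ?thesis by blast
  qed
  have interpolation: "\<exists>T>0. \<forall>u g R. u \<in> borel_measurable N \<longrightarrow> g \<in> hajlasz_grads d N \<alpha> u \<longrightarrow>
      (\<forall>k. Lp_norm N p (g k) \<le> R) \<longrightarrow> fs_norm B u \<le> ennreal \<eta> * R + ennreal T * Lp_fun_norm N p' u"
    if "0 < \<eta>" for \<eta>
    using hajlasz_interpolation[OF N(1) \<alpha> p(1) pos(3) q(2) that, of d] B
    unfolding HTL_space_def HB_space_def by fastforce
  define D where "D = (measure N (space N) + 1) powr (1 / p')"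
  have "0 < measure N (space N) + 1" by (simp add: add_nonneg_pos)
  then have D: "0 < D" by (simp add: D_def)
  have lower: "Lp_fun_norm N p' u \<le> ennreal D * R" if "u \<in> borel_measurable N" "Lp_fun_norm N p u \<le> R" for u R
    unfolding D_def Lp_fun_norm_def using that pos p N
    by (intro Lp_norm_le_higher_exponent) (auto simp: Lp_fun_norm_def)
  have bounded: "\<exists>K>0. \<forall>u\<in>fs_elems A. Lp_fun_norm N p' u < \<infinity> \<and> fs_norm B u \<le> ennreal K * fs_norm A u"
  proof -
    obtain T where T: "0 < T" "\<forall>u g R. u \<in> borel_measurable N \<longrightarrow> g \<in> hajlasz_grads d N \<alpha> u \<longrightarrow>
      (\<forall>k. Lp_norm N p (g k) \<le> R) \<longrightarrow> fs_norm B u \<le> ennreal 1 * R + ennreal T * Lp_fun_norm N p' u"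
      using interpolation[of 1] by auto
    define K where "K = c + T * D * c"
    have "0 < K" using c T(1) D by (simp add: K_def add_pos_pos)
    moreover have "Lp_fun_norm N p' u < \<infinity> \<and> fs_norm B u \<le> ennreal K * fs_norm A u" if u: "u \<in> fs_elems A" for u
    proof
      have um: "u \<in> borel_measurable N" using A_meas[OF u] .
      have "fs_norm A u < top" using A_fin[OF u] by simp
      then obtain s where "fs_norm A u < ennreal s"
        by (cases "fs_norm A u") (auto simp: ennreal_less_iff intro: that[of "enn2real (fs_norm A u) + 1"])
      then show "Lp_fun_norm N p' u < \<infinity>"
        using lower[OF um, of "ennreal (c * s)"] control[OF u, of s] D
        by (auto simp: ennreal_mult_less_top intro: le_less_trans)
      show "fs_norm B u \<le> ennreal K * fs_norm A u"
      proof (rule ennreal_mult_le_of_less[OF \<open>0 < K\<close>])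
        fix s assume s: "fs_norm A u < ennreal s" "0 < s"
        obtain g where g: "g \<in> hajlasz_grads d N \<alpha> u" "\<forall>k. Lp_norm N p (g k) \<le> ennreal (c * s)"
          using control[OF u s(1)] by blast
        have "fs_norm B u \<le> ennreal 1 * ennreal (c * s) + ennreal T * Lp_fun_norm N p' u"
          using T(2) um g by blast
        also have "\<dots> \<le> ennreal 1 * ennreal (c * s) + ennreal T * (ennreal D * ennreal (c * s))"
          using control[OF u s(1)] by (intro add_left_mono mult_left_mono lower um) auto
        also have "\<dots> = ennreal K * ennreal s"
          using c T(1) D s(2) by (simp add: K_def algebra_simps flip: ennreal_mult ennreal_plus)
        finally show "fs_norm B u \<le> ennreal K * ennreal s" .
      qed
    qed
    ultimately show ?thesis by blast
  qed
  then obtain K where K: "0 < K" "\<forall>u\<in>fs_elems A. Lp_fun_norm N p' u < \<infinity> \<and> fs_norm B u \<le> ennreal K * fs_norm A u"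
    by blast
  have sub: "fs_elems A \<subseteq> fs_elems B"
  proof
    fix u assume u: "u \<in> fs_elems A"
    have "fs_norm B u < \<infinity>"
      using K(2) u A_fin[OF u] by (auto simp: ennreal_mult_less_top intro: le_less_trans)
    then show "u \<in> fs_elems B" using A_meas[OF u] K(2) u by (auto simp: B_elems)
  qed
  have null: "E \<in> null_sets N" if "E \<in> null_sets M" for E
    using that N(2) C(2)[of E] by (auto simp: null_sets_def)
  have cont: "continuous_embedding A B"
    unfolding continuous_embedding_def
  proof (intro conjI ballI impI)
    fix u v assume "AE x in fs_measure A. u x = v x"
    moreover have "fs_measure A = M" "fs_measure B = N" using A B by (auto simp: HTL_space_def HB_space_def)
    ultimately show "AE x in fs_measure B. u x = v x"
      using null N(2)[THEN sets_eq_imp_space_eq] by (auto simp: eventually_ae_filter)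
  qed (use sub K in auto)
  have "fs_totally_bounded B S" if S: "fs_bounded A S" for S
  proof -
    have SA: "S \<subseteq> fs_elems A" using S by (simp add: fs_bounded_def)
    obtain R' where R': "\<forall>u\<in>S. fs_norm A u \<le> ennreal R'" using S by (auto simp: fs_bounded_def)
    define R where "R = c * (\<bar>R'\<bar> + 1)"
    have R: "0 < R" using c by (simp add: R_def)
    have lt: "fs_norm A u < ennreal (\<bar>R'\<bar> + 1)" if "u \<in> S" for u
    proof (rule le_less_trans)
      show "fs_norm A u \<le> ennreal R'" using R' that by blast
      show "ennreal R' < ennreal (\<bar>R'\<bar> + 1)" by (intro ennreal_lessI) auto
    qed
    have S1: "u \<in> borel_measurable N" and S2: "Lp_fun_norm N p u \<le> ennreal R"
      and S3: "\<exists>g\<in>hajlasz_grads d N \<alpha> u. \<forall>k. Lp_norm N p (g k) \<le> ennreal R" if "u \<in> S" for u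
      using control[OF _ lt[OF that]] that SA A_meas unfolding R_def by blast+
    have "\<exists>F. finite F \<and> F \<subseteq> fs_elems B \<and> (\<forall>u\<in>S. \<exists>f\<in>F. fs_norm B (\<lambda>x. u x - f x) < ennreal \<epsilon>)"
      if \<epsilon>: "0 < \<epsilon>" for \<epsilon>
    proof -
      define Q where "Q = 2 powr (1 + 1 / p)"
      have Q: "0 < Q" by (simp add: Q_def)
      define \<eta> where "\<eta> = \<epsilon> / (3 * (Q * R))"
      have \<eta>: "0 < \<eta>" "\<eta> * (Q * R) = \<epsilon> / 3" using \<epsilon> Q R by (auto simp: \<eta>_def)
      obtain T where T: "0 < T" "\<forall>u g R. u \<in> borel_measurable N \<longrightarrow> g \<in> hajlasz_grads d N \<alpha> u \<longrightarrow>
        (\<forall>k. Lp_norm N p (g k) \<le> R) \<longrightarrow> fs_norm B u \<le> ennreal \<eta> * R + ennreal T * Lp_fun_norm N p' u"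
        using interpolation[OF \<eta>(1)] by blast
      have "0 < \<epsilon> / (3 * T)" using \<epsilon> T by simp
      from hajlasz_family_finite_net[OF qm N pos(2) p less_imp_le[OF R] S1 S2 S3 this]
      obtain F where "finite F \<and> F \<subseteq> S \<and>
        (\<forall>u\<in>S. \<exists>f\<in>F. Lp_fun_norm N p' (\<lambda>x. u x - f x) \<le> ennreal (\<epsilon> / (3 * T)))" ..
      then have F: "finite F" "F \<subseteq> S"
        "\<forall>u\<in>S. \<exists>f\<in>F. Lp_fun_norm N p' (\<lambda>x. u x - f x) \<le> ennreal (\<epsilon> / (3 * T))"
        by simp_all
      have "\<exists>f\<in>F. fs_norm B (\<lambda>x. u x - f x) < ennreal \<epsilon>" if u: "u \<in> S" for u
      proof -
        obtain f where f: "f \<in> F" "f \<in> S" "Lp_fun_norm N p' (\<lambda>x. u x - f x) \<le> ennreal (\<epsilon> / (3 * T))"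
          using F u by blast
        obtain g where g: "g \<in> hajlasz_grads d N \<alpha> u" "\<forall>k. Lp_norm N p (g k) \<le> ennreal R"
          using S3[OF u] by blast
        obtain h where h: "h \<in> hajlasz_grads d N \<alpha> f" "\<forall>k. Lp_norm N p (h k) \<le> ennreal R"
          using S3[OF f(2)] by blast
        have gh: "Lp_norm N p (\<lambda>x. g k x + h k x) \<le> ennreal (Q * R)" for k
        proof -
          have "Lp_norm N p (\<lambda>x. g k x + h k x) \<le> ennreal Q * max (Lp_norm N p (g k)) (Lp_norm N p (h k))"
            unfolding Q_def using pos g h by (intro Lp_norm_add_le) (auto intro: hajlasz_grads_measurable)
          also have "\<dots> \<le> ennreal Q * ennreal R" using g h by (intro mult_left_mono) auto
          finally show ?thesis using Q R by (simp add: ennreal_mult)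
        qed
        have "(\<lambda>x. u x - f x) \<in> borel_measurable N" using S1[OF u] S1[OF f(2)] by simp
        then have "fs_norm B (\<lambda>x. u x - f x)
            \<le> ennreal \<eta> * ennreal (Q * R) + ennreal T * Lp_fun_norm N p' (\<lambda>x. u x - f x)"
          using T(2) hajlasz_grads_diff[OF g(1) h(1)] gh by blast
        also have "\<dots> \<le> ennreal \<eta> * ennreal (Q * R) + ennreal T * ennreal (\<epsilon> / (3 * T))"
          using f(3) by (intro add_left_mono mult_left_mono) auto
        also have "\<dots> = ennreal (\<epsilon> / 3 + \<epsilon> / 3)"
          using \<eta> T(1) \<epsilon> Q R by (simp flip: ennreal_mult ennreal_plus)
        also have "\<dots> < ennreal \<epsilon>" using \<epsilon> by (simp add: ennreal_less_iff)
        finally show ?thesis using f(1) by blast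
      qed
      moreover have "F \<subseteq> fs_elems B" using F(2) SA sub by (meson subset_trans)
      ultimately show ?thesis using F(1) by (intro exI[of _ F] conjI ballI)
    qed
    then show ?thesis using SA sub by (auto simp: fs_totally_bounded_def)
  qed
  then show ?thesis using cont by (simp add: compact_embedding_def)
qed

section \<open>Regular functions below the index\<close>

text \<open>
  Frink's chain inequality. Either an end link of the chain already carries half of \<open>W (x i) (x j)\<close>,
  or the first vertex at half that distance from \<open>x i\<close> splits the chain into two shorter ones that
  overlap in one link; interior links are counted twice to absorb the overlap.
\<close>

lemma frink_chain_inequality:
  fixes W :: "'a \<Rightarrow> 'a \<Rightarrow> real" and x :: "nat \<Rightarrow> 'a"
  assumes nn: "\<And>a b. a \<in> X \<Longrightarrow> b \<in> X \<Longrightarrow> 0 \<le> W a b"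
    and tri: "\<And>a b c. a \<in> X \<Longrightarrow> b \<in> X \<Longrightarrow> c \<in> X \<Longrightarrow> W a b \<le> 2 * max (W a c) (W c b)"
    and x: "\<And>i. x i \<in> X"
  shows "i + 2 \<le> j \<Longrightarrow> W (x i) (x j) \<le> 4 * (\<Sum>l = i..<j. W (x l) (x (Suc l)))
    - 2 * W (x i) (x (Suc i)) - 2 * W (x (j - 1)) (x j)"
proof (induction "j - i" arbitrary: i j rule: less_induct)
  case less
  define w where "w l = W (x l) (x (Suc l))" for l
  define b where "b = W (x i) (x j)"
  have w0: "0 \<le> w l" for l using nn x by (simp add: w_def)
  have ends: "w i + w (j - 1) \<le> (\<Sum>l = i..<j. w l)"
  proof -
    have "sum w {i, j - 1} \<le> (\<Sum>l = i..<j. w l)"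
      using less.prems w0 by (intro sum_mono2) auto
    then show ?thesis using less.prems by simp
  qed
  have wj: "W (x (j - 1)) (x j) = w (j - 1)" using less.prems by (simp add: w_def)
  have half: "b \<le> 2 * W (x i) (x r) \<or> b \<le> 2 * W (x r) (x j)" for r
    using tri[OF x x x, of i j r] by (auto simp: b_def max_def split: if_splits)
  have "b \<le> 4 * (\<Sum>l = i..<j. w l) - 2 * w i - 2 * w (j - 1)"
  proof (cases "b \<le> 2 * w i \<or> b \<le> 2 * w (j - 1)")
    case True
    then show ?thesis using ends w0[of i] w0[of "j - 1"] by linarith
  next
    case False
    define P where "P r \<longleftrightarrow> i + 1 \<le> r \<and> b \<le> 2 * W (x i) (x r)" for r
    have "P (j - 1)" using half[of "j - 1"] False less.prems unfolding P_def wj by auto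
    define r' where "r' = (LEAST r. P r)"
    have r': "P r'" "r' \<le> j - 1"
      unfolding r'_def by (rule LeastI[of P, OF \<open>P (j - 1)\<close>], rule Least_le[of P, OF \<open>P (j - 1)\<close>])
    have "r' \<noteq> i + 1" using r'(1) False by (auto simp: P_def w_def)
    then have "i + 2 \<le> r'" using r'(1) by (simp add: P_def)
    define r where "r = r' - 1"
    have r: "i + 1 \<le> r" "Suc r = r'" "r + 2 \<le> j"
      using \<open>i + 2 \<le> r'\<close> r'(2) less.prems by (auto simp: r_def)
    have "\<not> P r" using not_less_Least[of r P] r(2) by (simp add: r'_def)
    then have b2: "b \<le> 2 * W (x r) (x j)" using half[of r] r(1) by (simp add: P_def)
    have b1: "b \<le> 2 * W (x i) (x (Suc r))" using r'(1) r(2) by (simp add: P_def)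
    have "W (x i) (x (Suc r)) \<le> 4 * (\<Sum>l = i..<Suc r. w l) - 2 * w i - 2 * w r"
      using less.hyps[of "Suc r" i] r(1,3) by (simp add: w_def)
    moreover have "W (x r) (x j) \<le> 4 * (\<Sum>l = r..<j. w l) - 2 * w r - 2 * w (j - 1)"
      using less.hyps[of j r] r(1,3) wj by (simp add: w_def)
    moreover have "(\<Sum>l = i..<Suc r. w l) + (\<Sum>l = r..<j. w l) = (\<Sum>l = i..<j. w l) + w r"
      using sum.atLeastLessThan_concat[of i r j w] r(1,3) by simp
    ultimately show ?thesis using b1 b2 by linarith
  qed
  then show ?case unfolding wj by (simp only: b_def w_def)
qed

text \<open>
  The function is the chain distance from the base point, the largest function that vanishes there
  and increases by at most \<open>W x y\<close> from \<open>x\<close> to \<open>y\<close>; the chain inequality bounds it from below.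
\<close>

lemma lipschitz_distance_function:
  fixes W :: "'a \<Rightarrow> 'a \<Rightarrow> real"
  assumes nn: "\<And>a b. a \<in> X \<Longrightarrow> b \<in> X \<Longrightarrow> 0 \<le> W a b"
    and refl: "\<And>a. a \<in> X \<Longrightarrow> W a a = 0"
    and sym: "\<And>a b. a \<in> X \<Longrightarrow> b \<in> X \<Longrightarrow> W a b = W b a"
    and tri: "\<And>a b c. a \<in> X \<Longrightarrow> b \<in> X \<Longrightarrow> c \<in> X \<Longrightarrow> W a b \<le> 2 * max (W a c) (W c b)"
    and o: "x0 \<in> X"
  shows "\<exists>F. (\<forall>x\<in>X. W x0 x \<le> 4 * F x) \<and> (\<forall>x\<in>X. \<forall>y\<in>X. \<bar>F x - F y\<bar> \<le> W x y)"
proof -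
  define T where "T y = {s. \<exists>n x. (\<forall>i. x i \<in> X) \<and> x 0 = x0 \<and> x n = y \<and>
    s = (\<Sum>l = 0..<n. W (x l) (x (Suc l)))}" for y
  define F where "F y = Inf (T y)" for y
  have lower: "W x0 y / 4 \<le> s" if "s \<in> T y" for s y
  proof -
    obtain n x where x: "\<forall>i. x i \<in> X" "x 0 = x0" "x n = y" "s = (\<Sum>l = 0..<n. W (x l) (x (Suc l)))"
      using \<open>s \<in> T y\<close> unfolding T_def by blast
    consider "n = 0" | "n = 1" | "0 + 2 \<le> n" by linarith
    then show ?thesis
    proof cases
      case 1
      then show ?thesis using x refl[OF o] by simp
    next
      case 2
      then show ?thesis using x nn[OF o, of y] by auto
    next
      case 3
      have xX: "\<And>i. x i \<in> X" using x(1) by blast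
      have "W (x 0) (x n) \<le> 4 * (\<Sum>l = 0..<n. W (x l) (x (Suc l)))
          - 2 * W (x 0) (x (Suc 0)) - 2 * W (x (n - 1)) (x n)"
        by (rule frink_chain_inequality[of X W x, OF nn tri xX 3])
      moreover have "0 \<le> W (x 0) (x (Suc 0))" "0 \<le> W (x (n - 1)) (x n)" using nn xX by auto
      ultimately show ?thesis using x by simp
    qed
  qed
  have bdd: "bdd_below (T y)" for y using lower by (rule bdd_belowI)
  have ne: "T y \<noteq> {}" if "y \<in> X" for y
  proof -
    have "(\<Sum>l = 0..<1. W ((\<lambda>i. if i = 0 then x0 else y) l) ((\<lambda>i. if i = 0 then x0 else y) (Suc l))) \<in> T y"
      unfolding T_def using that o
      by (intro CollectI exI[of _ 1] exI[of _ "\<lambda>i :: nat. if i = 0 then x0 else y"]) auto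
    then show ?thesis by blast
  qed
  have step: "F y \<le> F x + W x y" if "x \<in> X" "y \<in> X" for x y
  proof -
    have "F y - W x y \<le> s" if s: "s \<in> T x" for s
    proof -
      obtain n z where z: "\<forall>i. z i \<in> X" "z 0 = x0" "z n = x" "s = (\<Sum>l = 0..<n. W (z l) (z (Suc l)))"
        using s unfolding T_def by blast
      define z' where "z' = z(Suc n := y)"
      have "s + W x y = (\<Sum>l = 0..<Suc n. W (z' l) (z' (Suc l)))"
        using z by (simp add: z'_def)
      moreover have "\<forall>i. z' i \<in> X" "z' 0 = x0" "z' (Suc n) = y"
        using z \<open>y \<in> X\<close> by (auto simp: z'_def)
      ultimately have "s + W x y \<in> T y" unfolding T_def by blast
      then have "F y \<le> s + W x y" unfolding F_def by (intro cInf_lower bdd)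
      then show ?thesis by simp
    qed
    then have "F y - W x y \<le> F x" unfolding F_def[of x] using ne[OF that(1)] by (intro cInf_greatest)
    then show ?thesis by simp
  qed
  have "\<bar>F x - F y\<bar> \<le> W x y" if "x \<in> X" "y \<in> X" for x y
    using step[OF that] step[OF that(2,1)] sym[OF that] by simp
  moreover have "W x0 x \<le> 4 * F x" if "x \<in> X" for x
  proof -
    have "W x0 x / 4 \<le> F x" unfolding F_def using ne[OF that] lower by (intro cInf_greatest)
    then show ?thesis by simp
  qed
  ultimately show ?thesis by blast
qed

lemma qm_const_properties:
  assumes "quasi_metric X \<rho>"
  shows "1 \<le> qm_const X \<rho>"
    and "x \<in> X \<Longrightarrow> y \<in> X \<Longrightarrow> z \<in> X \<Longrightarrow> \<rho> x y \<le> qm_const X \<rho> * max (\<rho> x z) (\<rho> z y)"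
proof -
  define Q where "Q = {\<rho> x y / max (\<rho> x z) (\<rho> z y) |x y z.
      x \<in> X \<and> y \<in> X \<and> z \<in> X \<and> \<not> (x = y \<and> y = z)}"
  have Qc: "qm_const X \<rho> = Sup Q" by (simp add: qm_const_def Q_def)
  have nn: "\<And>x y. x \<in> X \<Longrightarrow> y \<in> X \<Longrightarrow> 0 \<le> \<rho> x y"
    and eq0: "\<And>x y. x \<in> X \<Longrightarrow> y \<in> X \<Longrightarrow> \<rho> x y = 0 \<longleftrightarrow> x = y"
    using assms by (auto simp: quasi_metric_def)
  obtain C1 where C: "\<forall>x\<in>X. \<forall>y\<in>X. \<forall>z\<in>X. \<rho> x y \<le> C1 * max (\<rho> x z) (\<rho> z y)"
    using quasi_metric_constants[OF assms] by blast
  have mpos: "0 < max (\<rho> x z) (\<rho> z y)"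
    if "x \<in> X" "y \<in> X" "z \<in> X" "\<not> (x = y \<and> y = z)" for x y z
    using that nn[of x z] nn[of z y] eq0[of x z] eq0[of z y] by (auto simp: less_max_iff_disj order_less_le)
  have "q \<le> C1" if q: "q \<in> Q" for q
  proof -
    obtain x y z where *: "x \<in> X" "y \<in> X" "z \<in> X" "\<not> (x = y \<and> y = z)" "q = \<rho> x y / max (\<rho> x z) (\<rho> z y)"
      using q unfolding Q_def by blast
    then show ?thesis using C mpos[OF *(1-4)] by (auto simp: divide_le_eq)
  qed
  then have bdd: "bdd_above Q" by (auto simp: bdd_above_def)
  obtain a b where ab: "a \<in> X" "b \<in> X" "a \<noteq> b" using assms by (auto simp: quasi_metric_def)
  have "\<rho> a b / max (\<rho> a b) (\<rho> b b) \<in> Q" unfolding Q_def using ab by blast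
  moreover have "\<rho> a b / max (\<rho> a b) (\<rho> b b) = 1"
    using ab nn[of a b] eq0[of a b] eq0[of b b] by (simp add: max_def)
  ultimately show "1 \<le> qm_const X \<rho>" unfolding Qc using bdd by (auto intro: cSup_upper)
  show "\<rho> x y \<le> qm_const X \<rho> * max (\<rho> x z) (\<rho> z y)" if xyz: "x \<in> X" "y \<in> X" "z \<in> X"
  proof (cases "x = y \<and> y = z")
    case True
    then show ?thesis using eq0[OF xyz(1) xyz(1)] by simp
  next
    case False
    then have "\<rho> x y / max (\<rho> x z) (\<rho> z y) \<le> qm_const X \<rho>"
      unfolding Qc using xyz bdd by (intro cSup_upper) (auto simp: Q_def)
    then show ?thesis using mpos[OF xyz False] by (simp add: divide_le_eq)
  qed
qed

text \<open>
  Raising \<open>\<rho>\<close> to a power not above its exponent turns the quasi-metric constant into at most 2, which is the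
  constant that the chain argument can handle. Symmetrizing by the maximum does not increase the
  constant.
\<close>

lemma qm_exponent_distance_function:
  assumes \<rho>: "quasi_metric X \<rho>" and eqv: "qm_equivalent X \<rho> d" and d: "quasi_metric X d"
    and a: "0 < a" "ennreal a \<le> qm_exponent X \<rho>" and o: "x0 \<in> X"
  shows "\<exists>F. \<exists>c>0. (\<forall>x\<in>X. \<forall>y\<in>X. \<bar>F x - F y\<bar> \<le> c * d x y powr a) \<and> (\<forall>x\<in>X. d x0 x powr a \<le> c * F x)"
proof -
  define K where "K = qm_const X \<rho>"
  have K1: "1 \<le> K" and K: "\<And>x y z. x \<in> X \<Longrightarrow> y \<in> X \<Longrightarrow> z \<in> X \<Longrightarrow> \<rho> x y \<le> K * max (\<rho> x z) (\<rho> z y)"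
    using qm_const_properties[OF \<rho>] by (auto simp: K_def)
  have Ka: "K powr a \<le> 2"
  proof (cases "K = 1")
    case False
    then have l: "0 < log 2 K" using K1 by simp
    then have "ennreal a \<le> ennreal (inverse (log 2 K))"
      using a(2) by (simp add: qm_exponent_def K_def inverse_ennreal)
    then have "a \<le> inverse (log 2 K)" using l by (simp add: ennreal_le_iff)
    then have "log 2 K * a \<le> 1" using l by (simp add: field_simps)
    then have "2 powr (log 2 K * a) \<le> 2 powr 1" by (intro powr_mono) auto
    moreover have "2 powr (log 2 K * a) = K powr a" using K1 by (simp flip: powr_powr)
    ultimately show ?thesis by simp
  qed simp
  have nn: "\<And>x y. x \<in> X \<Longrightarrow> y \<in> X \<Longrightarrow> 0 \<le> \<rho> x y" and refl: "\<And>x. x \<in> X \<Longrightarrow> \<rho> x x = 0"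
    using \<rho> by (auto simp: quasi_metric_def)
  have dn: "\<And>x y. x \<in> X \<Longrightarrow> y \<in> X \<Longrightarrow> 0 \<le> d x y" using d by (auto simp: quasi_metric_def)
  define s where "s x y = max (\<rho> x y) (\<rho> y x)" for x y
  define W where "W x y = s x y powr a" for x y
  have s0: "0 \<le> s x y" if "x \<in> X" "y \<in> X" for x y using nn that by (simp add: s_def le_max_iff_disj)
  have str: "s x y \<le> K * max (s x z) (s z y)" if "x \<in> X" "y \<in> X" "z \<in> X" for x y z
  proof -
    have "K * max (\<rho> x z) (\<rho> z y) \<le> K * max (s x z) (s z y)"
      "K * max (\<rho> y z) (\<rho> z x) \<le> K * max (s x z) (s z y)"
      using K1 by (auto simp: s_def intro!: mult_left_mono)
    then show ?thesis using K[OF that] K[OF that(2,1,3)] by (simp add: s_def)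
  qed
  have tri: "W x y \<le> 2 * max (W x z) (W z y)" if "x \<in> X" "y \<in> X" "z \<in> X" for x y z
  proof -
    have m0: "0 \<le> max (s x z) (s z y)" using s0[OF that(1,3)] by (simp add: le_max_iff_disj)
    have "W x y \<le> (K * max (s x z) (s z y)) powr a"
      unfolding W_def using str[OF that] s0[OF that(1,2)] a(1) by (intro powr_mono2) auto
    also have "\<dots> = K powr a * max (s x z) (s z y) powr a"
      using K1 m0 by (simp add: powr_mult)
    also have "\<dots> \<le> 2 * max (s x z) (s z y) powr a"
      using Ka by (intro mult_right_mono) auto
    also have "max (s x z) (s z y) powr a \<le> max (W x z) (W z y)"
      by (auto simp: W_def max_def)
    finally show ?thesis by simp
  qed
  have "\<exists>F. (\<forall>x\<in>X. W x0 x \<le> 4 * F x) \<and> (\<forall>x\<in>X. \<forall>y\<in>X. \<bar>F x - F y\<bar> \<le> W x y)"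
    by (rule lipschitz_distance_function[OF _ _ _ tri o])
      (auto simp: W_def s_def refl max.commute)
  then obtain F where F: "\<forall>x\<in>X. W x0 x \<le> 4 * F x" "\<forall>x\<in>X. \<forall>y\<in>X. \<bar>F x - F y\<bar> \<le> W x y" by blast
  obtain \<kappa> where \<kappa>: "0 < \<kappa>" "\<forall>x\<in>X. \<forall>y\<in>X. inverse \<kappa> * \<rho> x y \<le> d x y \<and> d x y \<le> \<kappa> * \<rho> x y"
    using eqv by (auto simp: qm_equivalent_def)
  obtain C0 where C0: "1 \<le> C0" "\<forall>x\<in>X. \<forall>y\<in>X. d y x \<le> C0 * d x y"
    using quasi_metric_constants[OF d] by blast
  define c where "c = max ((\<kappa> * C0) powr a) (4 * \<kappa> powr a)"
  have "0 < c" using \<kappa>(1) by (simp add: c_def less_max_iff_disj)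
  have "\<bar>F x - F y\<bar> \<le> c * d x y powr a" if "x \<in> X" "y \<in> X" for x y
  proof -
    have "\<rho> x y \<le> \<kappa> * d x y" "\<rho> y x \<le> \<kappa> * d y x"
      using \<kappa> that by (auto simp: field_simps)
    moreover have "\<kappa> * d y x \<le> \<kappa> * (C0 * d x y)"
      using C0 \<kappa>(1) that by (intro mult_left_mono) auto
    moreover have "\<kappa> * d x y \<le> \<kappa> * (C0 * d x y)"
      using C0(1) \<kappa>(1) mult_right_mono[OF C0(1) dn[OF that]] by (intro mult_left_mono) auto
    ultimately have "s x y \<le> \<kappa> * C0 * d x y" by (simp add: s_def)
    then have "W x y \<le> (\<kappa> * C0 * d x y) powr a"
      unfolding W_def using s0[OF that] a(1) by (intro powr_mono2) auto
    also have "\<dots> = (\<kappa> * C0) powr a * d x y powr a"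
      using \<kappa>(1) C0(1) dn[OF that] by (simp add: powr_mult)
    also have "\<dots> \<le> c * d x y powr a" by (intro mult_right_mono) (auto simp: c_def)
    finally show ?thesis using F(2) that by fastforce
  qed
  moreover have "d x0 x powr a \<le> c * F x" if "x \<in> X" for x
  proof -
    have "d x0 x \<le> \<kappa> * \<rho> x0 x" using \<kappa> o that by blast
    also have "\<dots> \<le> \<kappa> * s x0 x" using \<kappa>(1) by (intro mult_left_mono) (auto simp: s_def)
    finally have "d x0 x powr a \<le> (\<kappa> * s x0 x) powr a" using dn[OF o that] a(1) by (intro powr_mono2) auto
    also have "\<dots> = \<kappa> powr a * W x0 x" using \<kappa>(1) s0[OF o that] by (simp add: W_def powr_mult)
    also have "\<dots> \<le> \<kappa> powr a * (4 * F x)" using F(1) that by (intro mult_left_mono) auto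
    also have "\<dots> = (4 * \<kappa> powr a) * F x" by simp
    also have "\<dots> \<le> c * F x"
    proof (rule mult_right_mono)
      have "0 \<le> W x0 x" by (simp add: W_def)
      then show "0 \<le> F x" using F(1) that by fastforce
    qed (simp add: c_def)
    finally show ?thesis .
  qed
  ultimately show ?thesis using \<open>0 < c\<close> by blast
qed

text \<open>
  Strictly below the index there is room for an exponent \<open>a > \<alpha>\<close>, and \<open>a - \<alpha>\<close> is the rate at which
  the gradient of a cut-off function decays at small scales. At the index only \<open>a = \<alpha>\<close> is possible,
  and it is available exactly when the supremum is attained.
\<close>

lemma below_index_distance_function:
  assumes d: "quasi_metric X d" and \<alpha>: "0 < \<alpha>" "below_index \<alpha> q X d" and o: "x0 \<in> X"
  shows "\<exists>a\<ge>\<alpha>. (\<alpha> < a \<or> q = \<infinity>) \<and> (\<exists>F. \<exists>c>0.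
    (\<forall>x\<in>X. \<forall>y\<in>X. \<bar>F x - F y\<bar> \<le> c * d x y powr a) \<and> (\<forall>x\<in>X. d x0 x powr a \<le> c * F x))"
proof -
  have "\<exists>a\<ge>\<alpha>. (\<alpha> < a \<or> q = \<infinity>) \<and> (\<exists>\<rho>. quasi_metric X \<rho> \<and> qm_equivalent X \<rho> d \<and> ennreal a \<le> qm_exponent X \<rho>)"
  proof (cases "ennreal \<alpha> = qm_index X d")
    case True
    then show ?thesis
      using \<alpha>(2) unfolding below_index_def qm_index_attained_def by (metis order_refl)
  next
    case False
    then have "ennreal \<alpha> < qm_index X d" using \<alpha>(2) by (simp add: below_index_def order_less_le)
    then obtain \<rho> where \<rho>: "quasi_metric X \<rho>" "qm_equivalent X \<rho> d" "ennreal \<alpha> < qm_exponent X \<rho>"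
      unfolding qm_index_def less_SUP_iff by blast
    obtain e where e: "ennreal \<alpha> < e" "e < qm_exponent X \<rho>" using dense[OF \<rho>(3)] by blast
    then obtain a where a: "e = ennreal a" "0 \<le> a" by (cases e) (auto simp: top_unique)
    then have "\<alpha> < a" using e(1) \<alpha>(1) by (simp add: ennreal_less_iff)
    then show ?thesis using \<rho> e(2) a by (intro exI[of _ a]) auto
  qed
  then obtain a \<rho> where *: "\<alpha> \<le> a" "\<alpha> < a \<or> q = \<infinity>" "quasi_metric X \<rho>" "qm_equivalent X \<rho> d"
    "ennreal a \<le> qm_exponent X \<rho>" by blast
  have "0 < a" using *(1) \<alpha>(1) by simp
  from qm_exponent_distance_function[OF *(3,4) d this *(5) o] show ?thesis using *(1,2) by blast
qed

section \<open>Continuity of the embedding forces finite measure\<close>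

text \<open>
  The inequality compares \<open>m\<close> at \<open>t\<close> and \<open>t + h\<close> with a gain in the exponent and a loss in \<open>h\<close> that
  is only polynomial. Along \<open>t\<^sub>j = t + 1 - 2\<^sup>-\<^sup>j\<close> the gain wins once \<open>m t\<close> is large, so \<open>m t\<^sub>j\<close> would grow
  without bound although \<open>m (t + 1)\<close> is finite.
\<close>

lemma bounded_of_self_improvement:
  fixes m :: "real \<Rightarrow> real"
  assumes m: "\<And>t. 0 \<le> m t" "mono m" and p: "0 < p'" "p' < p" and H: "0 < H"
    and ineq: "\<And>t h. 0 < h \<Longrightarrow> h \<le> 1 \<Longrightarrow> m t powr (1 / p') \<le> H / h * m (t + h) powr (1 / p)"
  shows "\<exists>T. \<forall>t. m t \<le> T"
proof -
  define \<sigma> where "\<sigma> = p / p'"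
  have \<sigma>: "1 < \<sigma>" using p by (simp add: \<sigma>_def)
  \<comment> \<open>Raising \<open>T * b ^ j\<close> to the power \<open>\<sigma>\<close> must gain a factor \<open>b\<close> after the loss \<open>(H / h) powr p\<close>
    with \<open>h = (1 / 2) ^ Suc j\<close>: the growth of this loss in \<open>j\<close> fixes \<open>b\<close>, and the rest fixes \<open>T\<close>.\<close>
  define b where "b = 2 powr (p / (\<sigma> - 1))"
  have b: "1 < b" using p \<sigma> by (simp add: b_def)
  have b\<sigma>: "b powr (\<sigma> - 1) = 2 powr p" using \<sigma> by (simp add: b_def powr_powr)
  define T where "T = ((2 * H) powr p * b) powr (1 / (\<sigma> - 1))"
  have T: "0 < T" using H b by (simp add: T_def)
  have T\<sigma>: "T powr (\<sigma> - 1) = (2 * H) powr p * b" using H b \<sigma> by (simp add: T_def powr_powr)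
  have "m t \<le> T" for t
  proof (rule ccontr)
    assume "\<not> m t \<le> T"
    then have mt: "T \<le> m t" by simp
    define r where "r j = t + 1 - (1 / 2) ^ j" for j :: nat
    have grow: "T * b ^ j \<le> m (r j)" for j
    proof (induction j)
      case 0
      then show ?case using mt by (simp add: r_def)
    next
      case (Suc j)
      define h where "h = (1 / 2 :: real) ^ Suc j"
      have h: "0 < h" "r j + h = r (Suc j)" by (simp_all add: h_def r_def)
      have h1: "h \<le> 1" unfolding h_def by (rule power_le_one) auto
      have "m (r j) powr (1 / p') \<le> H / h * m (r (Suc j)) powr (1 / p)"
        using ineq[OF h(1) h1, of "r j"] h(2) by simp
      then have "(m (r j) powr (1 / p')) powr p \<le> (H / h * m (r (Suc j)) powr (1 / p)) powr p"
        using p by (intro powr_mono2) auto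
      also have "\<dots> = (H / h) powr p * m (r (Suc j))"
        unfolding powr_mult powr_powr using p m(1)[of "r (Suc j)"] by simp
      finally have up: "m (r j) powr \<sigma> \<le> (H / h) powr p * m (r (Suc j))"
        by (simp add: powr_powr \<sigma>_def)
      have hp: "(H / h) powr p = (2 * H) powr p * (2 powr p) ^ j"
      proof -
        have "H / h = (2 * H) * 2 ^ j" by (simp add: h_def power_one_over field_simps)
        then have "(H / h) powr p = (2 * H) powr p * (2 ^ j) powr p" using H by (simp add: powr_mult)
        also have "(2 ^ j) powr p = (2 powr p) ^ j"
          by (simp add: powr_powr mult.commute flip: powr_realpow)
        finally show ?thesis .
      qed
      have "(H / h) powr p * (T * b ^ Suc j) = (T * b ^ j) powr \<sigma>"
      proof -
        have "(T * b ^ j) powr \<sigma> = (T * b ^ j) powr 1 * (T * b ^ j) powr (\<sigma> - 1)"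
          by (simp only: powr_add[symmetric]) simp
        also have "\<dots> = (T * b ^ j) * (T powr (\<sigma> - 1) * (b powr (\<sigma> - 1)) ^ j)"
          using T b by (simp add: powr_mult powr_powr mult.commute flip: powr_realpow)
        finally show ?thesis by (simp add: hp T\<sigma> b\<sigma>)
      qed
      also have "\<dots> \<le> m (r j) powr \<sigma>" using Suc T b \<sigma> by (intro powr_mono2) auto
      also note up
      finally show ?case using H h(1) by simp
    qed
    obtain j where j: "m (t + 1) / T < b ^ j" using real_arch_pow[OF b] by blast
    have "T * b ^ j \<le> m (t + 1)"
      using grow[of j] monoD[OF m(2), of "r j" "t + 1"] by (simp add: r_def)
    then show False using j T by (simp add: field_simps)
  qed
  then show ?thesis by blast
qed

lemma Lp_norm_const_indicator:
  assumes "0 < p" "E \<in> sets m" "emeasure m E < \<infinity>" "0 \<le> a"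
  shows "Lp_norm m p (\<lambda>x. ennreal a * indicator E x) = ennreal (a * measure m E powr (1 / p))"
proof -
  have "(\<integral>\<^sup>+ x. epowr (ennreal a * indicator E x) p \<partial>m) = (\<integral>\<^sup>+ x. ennreal (a powr p) * indicator E x \<partial>m)"
    using assms by (intro nn_integral_cong) (auto simp: epowr_ennreal indicator_def)
  also have "\<dots> = ennreal (a powr p * measure m E)"
    using assms by (simp add: nn_integral_cmult_indicator emeasure_eq_ennreal_measure ennreal_mult less_top)
  finally show ?thesis
    using assms by (simp add: Lp_norm_def epowr_ennreal powr_mult powr_powr)
qed

text \<open>
  Cut-off functions of sublevel sets of \<open>F\<close>. A gradient of a cut-off function lives where the
  function does: of two points with different values, one is in the larger sublevel set.
\<close>

lemma cutoff_norm_le: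
  assumes F: "\<And>x y. x \<in> space M \<Longrightarrow> y \<in> space M \<Longrightarrow> \<bar>F x - F y\<bar> \<le> c * d x y powr a"
    and c: "0 < c" and Fm: "F \<in> borel_measurable M"
    and fin: "emeasure M {x \<in> space M. F x < t + h} < \<infinity>" and h: "0 < h" "h \<le> 1"
    and \<alpha>: "0 < \<alpha>" "\<alpha> \<le> a" and p: "0 < p" and q: "0 < q"
    and L: "lq_norm q (two_sided_geometric (min (a - \<alpha>) \<alpha>)) \<le> ennreal L" "0 \<le> L"
  defines "\<phi> \<equiv> \<lambda>x. max 0 (min 1 ((t + h - F x) / h))"
    and "K \<equiv> (1 + L * (2 powr \<alpha> + c)) / h * measure M {x \<in> space M. F x < t + h} powr (1 / p)"
  shows "HTL_norm d M \<alpha> p q \<phi> \<le> ennreal K" "HB_norm d M \<alpha> p q \<phi> \<le> ennreal K"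
proof -
  note [measurable] = Fm
  define \<Omega> where "\<Omega> = {x \<in> space M. F x < t + h}"
  have [measurable]: "\<Omega> \<in> sets M" unfolding \<Omega>_def by measurable
  define \<delta> where "\<delta> = min (a - \<alpha>) \<alpha>"
  define w where "w = two_sided_geometric \<delta>"
  define \<Gamma> where "\<Gamma> = (2 powr \<alpha> + c) / h"
  have \<Gamma>: "0 \<le> \<Gamma>" using c h by (simp add: \<Gamma>_def)
  define G where "G x = ennreal \<Gamma> * indicator \<Omega> x" for x
  have [measurable]: "G \<in> borel_measurable M" unfolding G_def by measurable
  have out: "\<phi> x = 0" if "x \<in> space M - \<Omega>" for x
    using that h by (auto simp: \<phi>_def \<Omega>_def max_def min_def divide_le_eq field_simps)
  have bd: "0 \<le> \<phi> x" "\<phi> x \<le> 1" for x by (auto simp: \<phi>_def)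
  have lip: "\<bar>\<phi> x - \<phi> y\<bar> \<le> \<bar>F x - F y\<bar> / h" for x y
  proof -
    have "\<bar>max 0 (min 1 b) - max 0 (min 1 b')\<bar> \<le> \<bar>b - b'\<bar>" for b b' :: real
      by (auto simp: max_def min_def)
    then have "\<bar>\<phi> x - \<phi> y\<bar> \<le> \<bar>(t + h - F x) / h - (t + h - F y) / h\<bar>"
      unfolding \<phi>_def .
    also have "(t + h - F x) / h - (t + h - F y) / h = (F y - F x) / h"
      by (simp add: diff_divide_distrib)
    finally show ?thesis using h by (simp add: abs_minus_commute)
  qed
  have pw: "ennreal \<bar>\<phi> x - \<phi> y\<bar> \<le> ennreal (d x y powr \<alpha>) * (w k * G x + w k * G y)"
    if xy: "x \<in> space M - {}" "y \<in> space M - {}" and sh: "2 powi (- k - 1) \<le> d x y \<and> d x y < 2 powi (- k)"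
    for k x y
  proof (cases "x \<in> \<Omega> \<or> y \<in> \<Omega>")
    case False
    then show ?thesis using out xy by simp
  next
    case True
    have "\<bar>\<phi> x - \<phi> y\<bar> \<le> d x y powr \<alpha> * (2 powr (- \<delta> * \<bar>real_of_int k\<bar>) * \<Gamma>)"
    proof (cases "0 \<le> k")
      case True
      have "d x y powr (a - \<alpha>) \<le> 2 powr (- (a - \<alpha>) * k)"
        using dyadic_shell_powr(2)[OF sh, of "a - \<alpha>"] \<alpha> by simp
      also have "\<dots> \<le> 2 powr (- \<delta> * \<bar>real_of_int k\<bar>)"
        using True mult_right_mono[of \<delta> "a - \<alpha>" "real_of_int k"]
        by (intro powr_mono) (auto simp: \<delta>_def algebra_simps)
      finally have da: "d x y powr (a - \<alpha>) \<le> 2 powr (- \<delta> * \<bar>real_of_int k\<bar>)" .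
      have "\<bar>F x - F y\<bar> / h \<le> c * d x y powr a / h"
        using F xy h by (intro divide_right_mono) auto
      then have "\<bar>\<phi> x - \<phi> y\<bar> \<le> c * d x y powr a / h"
        using lip[of x y] by linarith
      also have "c * d x y powr a / h = d x y powr \<alpha> * (d x y powr (a - \<alpha>) * (c / h))"
        by (simp flip: powr_add add: mult.assoc[symmetric])
      also have "\<dots> \<le> d x y powr \<alpha> * (2 powr (- \<delta> * \<bar>real_of_int k\<bar>) * \<Gamma>)"
        using da c h by (intro mult_left_mono mult_mono) (auto simp: \<Gamma>_def intro!: divide_right_mono)
      finally show ?thesis .
    next
      case False
      have "\<bar>\<phi> x - \<phi> y\<bar> \<le> 1" using bd[of x] bd[of y] by linarith
      also have "1 = 2 powr (- \<alpha> * (real_of_int k + 1)) * (2 powr (\<alpha> * real_of_int k) * 2 powr \<alpha>)"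
        by (simp add: algebra_simps flip: powr_add)
      also have "\<dots> \<le> d x y powr \<alpha> * (2 powr (- \<delta> * \<bar>real_of_int k\<bar>) * \<Gamma>)"
      proof (intro mult_mono)
        show "2 powr (- \<alpha> * (real_of_int k + 1)) \<le> d x y powr \<alpha>"
          using dyadic_shell_powr(3)[OF sh, of \<alpha>] \<alpha> by simp
        have "\<delta> * \<bar>real_of_int k\<bar> \<le> \<alpha> * \<bar>real_of_int k\<bar>"
          by (intro mult_right_mono) (auto simp: \<delta>_def)
        then show "2 powr (\<alpha> * real_of_int k) \<le> 2 powr (- \<delta> * \<bar>real_of_int k\<bar>)"
          using False by (intro powr_mono) auto
        have "2 powr \<alpha> \<le> (2 powr \<alpha> + c) / 1" using c by simp
        also have "\<dots> \<le> \<Gamma>" unfolding \<Gamma>_def using h c by (intro divide_left_mono) (auto simp: add_nonneg_pos)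
        finally show "2 powr \<alpha> \<le> \<Gamma>" .
      qed auto
      finally show ?thesis .
    qed
    then have "ennreal \<bar>\<phi> x - \<phi> y\<bar> \<le> ennreal (d x y powr \<alpha> * (2 powr (- \<delta> * \<bar>real_of_int k\<bar>) * \<Gamma>))"
      by (rule ennreal_leI)
    also have "\<dots> = ennreal (d x y powr \<alpha>) * (w k * ennreal \<Gamma>)"
      using \<Gamma> by (simp add: w_def two_sided_geometric_def ennreal_mult)
    also have "\<dots> \<le> ennreal (d x y powr \<alpha>) * (w k * G x + w k * G y)"
      using True by (intro mult_left_mono) (auto simp: G_def indicator_def)
    finally show ?thesis .
  qed
  define \<mu> where "\<mu> = measure M \<Omega> powr (1 / p)"
  have fin': "emeasure M \<Omega> < \<infinity>" using fin by (simp add: \<Omega>_def)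
  have "Lp_fun_norm M p \<phi> \<le> Lp_norm M p (\<lambda>x. ennreal 1 * indicator \<Omega> x)"
    unfolding Lp_fun_norm_def using p out bd by (intro Lp_norm_mono) (auto simp: indicator_def ennreal_le_1)
  also have "\<dots> = ennreal \<mu>"
    using p fin' by (subst Lp_norm_const_indicator) (auto simp: \<mu>_def)
  finally have n1: "Lp_fun_norm M p \<phi> \<le> ennreal \<mu>" .
  have n2: "Lp_norm M p G = ennreal (\<Gamma> * \<mu>)"
    unfolding G_def \<mu>_def using p fin' \<Gamma> by (intro Lp_norm_const_indicator) auto
  have "Lp_fun_norm M p \<phi> + lq_norm q w * Lp_norm M p G \<le> ennreal \<mu> + ennreal L * ennreal (\<Gamma> * \<mu>)"
    unfolding n2 using n1 L(1) by (intro add_mono mult_right_mono) (auto simp: w_def \<delta>_def)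
  also have "\<dots> = ennreal (\<mu> + L * (\<Gamma> * \<mu>))"
    using L(2) \<Gamma> by (simp add: \<mu>_def flip: ennreal_mult ennreal_plus)
  also have "\<dots> \<le> ennreal K"
  proof (rule ennreal_leI)
    have "1 \<le> 1 / h" using h by simp
    moreover have "(1 + L * (2 powr \<alpha> + c)) / h = 1 / h + L * \<Gamma>"
      unfolding \<Gamma>_def add_divide_distrib[of 1 "L * (2 powr \<alpha> + c)" h] by simp
    ultimately have "1 + L * \<Gamma> \<le> (1 + L * (2 powr \<alpha> + c)) / h" by simp
    then have "(1 + L * \<Gamma>) * \<mu> \<le> (1 + L * (2 powr \<alpha> + c)) / h * \<mu>"
      by (intro mult_right_mono) (auto simp: \<mu>_def)
    then show "\<mu> + L * (\<Gamma> * \<mu>) \<le> K" by (simp add: K_def \<mu>_def \<Omega>_def algebra_simps)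
  qed
  finally have le: "Lp_fun_norm M p \<phi> + lq_norm q w * Lp_norm M p G \<le> ennreal K" .
  show "HTL_norm d M \<alpha> p q \<phi> \<le> ennreal K" "HB_norm d M \<alpha> p q \<phi> \<le> ennreal K"
    using norms_le_of_product_gradient[of p q G M "{}" d \<phi> \<alpha> w, OF p q _ _ pw] le
    by (auto intro: order_trans)
qed

lemma sublevel_set_measurable:
  assumes qm: "quasi_metric_measure_space M d" and c: "0 < c" "0 < a"
    and F: "\<And>x y. x \<in> space M \<Longrightarrow> y \<in> space M \<Longrightarrow> \<bar>F x - F y\<bar> \<le> c * d x y powr a"
  shows "{x \<in> space M. F x < t} \<in> sets M"
proof -
  have "{x \<in> space M. F x < t} \<in> qopens (space M) d"
    unfolding qopens_def
  proof safe
    fix x assume x: "x \<in> space M" "F x < t"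
    define r where "r = ((t - F x) / c) powr (1 / a)"
    have r: "0 < r" using x c by (simp add: r_def)
    have "F y < t" if y: "y \<in> space M" "d x y < r" for y
    proof -
      have "0 \<le> d x y"
        using qm x(1) y(1) by (auto simp: quasi_metric_measure_space_def quasi_metric_def)
      then have "d x y powr a < r powr a" using y c by (intro powr_less_mono2) auto
      also have "r powr a = (t - F x) / c" using x c by (simp add: r_def powr_powr)
      finally have "c * d x y powr a < t - F x" using c by (simp add: field_simps)
      then show ?thesis using F[OF x(1) y(1)] by linarith
    qed
    then have "qball (space M) d x r \<subseteq> {x \<in> space M. F x < t}" by (auto simp: qball_def)
    then show "\<exists>r>0. qball (space M) d x r \<subseteq> {x \<in> space M. F x < t}" using r by blast
  qed
  then show ?thesis using qm by (auto simp: quasi_metric_measure_space_def)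
qed

text \<open>
  Testing the embedding with cut-off functions bounds the measure of a sublevel set, with the
  exponent \<open>1 / p'\<close>, by that of a slightly larger one with the smaller exponent \<open>1 / p\<close>. The measures of
  the two sets need not be comparable, so the inequality is iterated over infinitely many levels in
  a bounded range, all of whose sublevel sets lie in one ball.
\<close>

lemma embedding_implies_finite_measure:
  fixes M :: "'a measure"
  assumes qm: "quasi_metric_measure_space M d" and p: "0 < p'" "p' < p" and q: "0 < q"
    and \<alpha>: "0 < \<alpha>" "below_index \<alpha> q (space M) d"
    and A: "A = HTL_space d M \<alpha> p q \<or> A = HB_space d M \<alpha> p q"
    and B: "B = HTL_space d M \<beta> p' r \<or> B = HB_space d M \<beta> p' r"
    and emb: "continuous_embedding A B"
  shows "emeasure M (space M) < \<infinity>"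
proof -
  have qd: "quasi_metric (space M) d" using qm by (simp add: quasi_metric_measure_space_def)
  obtain x0 where x0: "x0 \<in> space M" using qd by (auto simp: quasi_metric_def)
  from below_index_distance_function[OF qd \<alpha> x0]
  obtain a F c where a: "\<alpha> \<le> a" "\<alpha> < a \<or> q = \<infinity>" and c: "0 < c"
    and F1: "\<forall>x\<in>space M. \<forall>y\<in>space M. \<bar>F x - F y\<bar> \<le> c * d x y powr a"
    and F2: "\<forall>x\<in>space M. d x0 x powr a \<le> c * F x"
    by blast
  have a0: "0 < a" using a(1) \<alpha>(1) by simp
  have p0: "0 < p" using p by simp
  have lip: "\<And>x y. x \<in> space M \<Longrightarrow> y \<in> space M \<Longrightarrow> \<bar>F x - F y\<bar> \<le> c * d x y powr a" using F1 by blast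
  define \<Omega> where "\<Omega> t = {x \<in> space M. F x < t}" for t
  have meas [measurable]: "\<Omega> t \<in> sets M" for t
    unfolding \<Omega>_def by (rule sublevel_set_measurable[OF qm c a0 lip])
  then have Fm [measurable]: "F \<in> borel_measurable M"
    unfolding borel_measurable_iff_less \<Omega>_def by blast
  have fin: "emeasure M (\<Omega> t) < \<infinity>" for t
  proof -
    define s where "s = (c * \<bar>t\<bar> + 1) powr (1 / a)"
    have ct: "0 < c * \<bar>t\<bar> + 1" using c by (simp add: add_nonneg_pos)
    then have s: "0 < s" "s powr a = c * \<bar>t\<bar> + 1" using a0 by (auto simp: s_def powr_powr)
    have "\<Omega> t \<subseteq> qball (space M) d x0 s"
    proof
      fix x assume "x \<in> \<Omega> t"
      then have x: "x \<in> space M" "F x < t" by (auto simp: \<Omega>_def)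
      have "d x0 x powr a \<le> c * F x" using F2 x by blast
      also have "\<dots> < c * \<bar>t\<bar> + 1" using x(2) c mult_left_mono[of "F x" "\<bar>t\<bar>" c] by linarith
      finally have "d x0 x powr a < s powr a" using s by simp
      then have "d x0 x < s" using powr_mono2[of a s "d x0 x"] a0 s(1) by (auto simp: not_less[symmetric])
      then show "x \<in> qball (space M) d x0 s" using x by (simp add: qball_def)
    qed
    moreover have "qball (space M) d x0 s \<in> sets M" "emeasure M (qball (space M) d x0 s) < \<infinity>"
      using qm x0 s(1) by (auto simp: quasi_metric_measure_space_def)
    ultimately show ?thesis by (meson emeasure_mono le_less_trans)
  qed
  define m where "m t = measure M (\<Omega> t)" for t
  have em: "emeasure M (\<Omega> t) = ennreal (m t)" for t
    using fin[of t] by (simp add: m_def emeasure_eq_ennreal_measure less_top)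
  have mono: "mono m"
    unfolding m_def using fin
    by (intro monoI measure_mono_fmeasurable) (auto simp: fmeasurable_def \<Omega>_def[of x for x])
  define \<delta> where "\<delta> = min (a - \<alpha>) \<alpha>"
  define L where "L = enn2real (lq_norm q (two_sided_geometric \<delta>))"
  have L: "lq_norm q (two_sided_geometric \<delta>) \<le> ennreal L" "0 \<le> L"
    using lq_norm_two_sided_geometric[of q \<delta>] q a \<alpha>(1) by (auto simp: L_def \<delta>_def less_top)
  obtain C where C: "0 < C" "\<forall>u\<in>fs_elems A. fs_norm B u \<le> ennreal C * fs_norm A u"
    using emb by (auto simp: continuous_embedding_def)
  define H where "H = C * (1 + L * (2 powr \<alpha> + c))"
  have H0: "0 < 1 + L * (2 powr \<alpha> + c)" using L(2) c by (simp add: add_pos_nonneg)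
  then have H: "0 < H" using C(1) by (simp add: H_def)
  have "m t powr (1 / p') \<le> H / h * m (t + h) powr (1 / p)" if h: "0 < h" "h \<le> 1" for t h
  proof -
    define \<phi> where "\<phi> = (\<lambda>x. max 0 (min 1 ((t + h - F x) / h)))"
    define K where "K = (1 + L * (2 powr \<alpha> + c)) / h * m (t + h) powr (1 / p)"
    have K0: "0 \<le> K" using H0 h by (simp add: K_def)
    have [measurable]: "\<phi> \<in> borel_measurable M" unfolding \<phi>_def by measurable
    have nA: "HTL_norm d M \<alpha> p q \<phi> \<le> ennreal K" "HB_norm d M \<alpha> p q \<phi> \<le> ennreal K"
      unfolding \<phi>_def K_def m_def \<Omega>_def
      by (rule cutoff_norm_le[OF lip c Fm fin[unfolded \<Omega>_def] h \<alpha>(1) a(1) p0 q L[unfolded \<delta>_def]]; assumption)+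
    then have "fs_norm A \<phi> \<le> ennreal K" using A by (auto simp: HTL_space_def HB_space_def)
    moreover have "HTL_norm d M \<alpha> p q \<phi> < \<infinity>" "HB_norm d M \<alpha> p q \<phi> < \<infinity>"
      using nA[THEN le_less_trans, of \<infinity>] by simp_all
    moreover have "Lp_fun_norm M p \<phi> < \<infinity>"
      using order_trans[OF Lp_fun_norm_le_HTL_HB_norm(1) nA(1)] by (auto intro: le_less_trans)
    ultimately have "\<phi> \<in> fs_elems A"
      using A by (auto simp: HTL_space_def HB_space_def)
    then have "fs_norm B \<phi> \<le> ennreal C * fs_norm A \<phi>" using C(2) by blast
    also have "\<dots> \<le> ennreal C * ennreal K"
      using \<open>fs_norm A \<phi> \<le> ennreal K\<close> by (intro mult_left_mono) auto
    also have "\<dots> = ennreal (C * K)" using C(1) K0 by (simp add: ennreal_mult)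
    finally have up: "fs_norm B \<phi> \<le> ennreal (C * K)" .
    have "ennreal (m t powr (1 / p')) = Lp_norm M p' (\<lambda>x. ennreal 1 * indicator (\<Omega> t) x)"
      using p fin[of t] by (subst Lp_norm_const_indicator) (auto simp: m_def)
    also have "\<dots> \<le> Lp_fun_norm M p' \<phi>"
      unfolding Lp_fun_norm_def using p h
      by (intro Lp_norm_mono) (auto simp: indicator_def \<phi>_def \<Omega>_def min_def le_divide_eq)
    also have "\<dots> \<le> fs_norm B \<phi>"
      using B Lp_fun_norm_le_HTL_HB_norm[of M p' \<phi> d \<beta> r] by (auto simp: HTL_space_def HB_space_def)
    also note up
    finally have "m t powr (1 / p') \<le> C * K" using C(1) K0 by simp
    then show ?thesis by (simp add: K_def H_def)
  qed
  then have "\<exists>T. \<forall>t. m t \<le> T"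
    using p H mono by (intro bounded_of_self_improvement[of m p' p H]) (auto simp: m_def)
  then obtain T where T: "\<forall>t. m t \<le> T" by blast
  have "incseq (\<lambda>n. \<Omega> (real n))" by (auto simp: incseq_def \<Omega>_def)
  then have "(SUP n. emeasure M (\<Omega> (real n))) = emeasure M (\<Union>n. \<Omega> (real n))"
    by (intro SUP_emeasure_incseq) auto
  moreover have "(\<Union>n. \<Omega> (real n)) = space M"
    using reals_Archimedean2 by (auto simp: \<Omega>_def)
  moreover have "(SUP n. emeasure M (\<Omega> (real n))) \<le> ennreal T"
    using T by (intro SUP_least) (auto simp: em intro: ennreal_leI)
  ultimately show ?thesis by (simp add: le_less_trans)
qed

section \<open>Compact embeddings and finiteness of the measure\<close>

theorem corollary7p6:
  fixes M :: "'a measure" and d :: "'a \<Rightarrow> 'a \<Rightarrow> real"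
  assumes "quasi_metric_measure_space M d"
  shows
    "(\<forall>(N :: 'a measure) (C::real) (\<alpha>::real) (p::real) (q::ennreal) (r::ennreal) (\<beta>::real) (p'::real).
        finite_measure N \<and> sets N = sets M \<and>
        0 < C \<and> (\<forall>A\<in>sets M. emeasure N A \<le> ennreal C * emeasure M A) \<and>
        0 < \<alpha> \<and> 0 < p \<and> 0 < q \<and> 0 < r \<and> 0 < \<beta> \<and> \<beta> < \<alpha> \<and> 0 < p' \<and> p' < p \<longrightarrow>
        compact_embedding (HTL_space d M \<alpha> p q) (HTL_space d N \<beta> p' r) \<and>
        compact_embedding (HTL_space d M \<alpha> p q) (HB_space d N \<beta> p' r) \<and>
        compact_embedding (HB_space d M \<alpha> p q) (HTL_space d N \<beta> p' r) \<and>
        compact_embedding (HB_space d M \<alpha> p q) (HB_space d N \<beta> p' r)) \<and>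
     (emeasure M (space M) < \<infinity> \<longrightarrow>
        (\<forall>(\<alpha>::real) (p::real) (q::ennreal) (r::ennreal) (\<beta>::real) (p'::real).
           0 < \<alpha> \<and> 0 < p \<and> 0 < q \<and> 0 < r \<and> 0 < \<beta> \<and> \<beta> < \<alpha> \<and> 0 < p' \<and> p' < p \<longrightarrow>
           compact_embedding (HTL_space d M \<alpha> p q) (HTL_space d M \<beta> p' r) \<and>
           compact_embedding (HTL_space d M \<alpha> p q) (HB_space d M \<beta> p' r) \<and>
           compact_embedding (HB_space d M \<alpha> p q) (HTL_space d M \<beta> p' r) \<and>
           compact_embedding (HB_space d M \<alpha> p q) (HB_space d M \<beta> p' r))) \<and>
     ((\<exists>(\<alpha>::real) (p::real) (q::ennreal) (r::ennreal) (\<beta>::real) (p'::real).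
         0 < p \<and> 0 < \<beta> \<and> 0 < p' \<and> p' < p \<and> 0 < q \<and> 0 < r \<and>
         0 < \<alpha> \<and> below_index \<alpha> q (space M) d \<and>
         (continuous_embedding (HTL_space d M \<alpha> p q) (HTL_space d M \<beta> p' r) \<or>
          continuous_embedding (HTL_space d M \<alpha> p q) (HB_space d M \<beta> p' r) \<or>
          continuous_embedding (HB_space d M \<alpha> p q) (HTL_space d M \<beta> p' r) \<or>
          continuous_embedding (HB_space d M \<alpha> p q) (HB_space d M \<beta> p' r))) \<longrightarrow>
      emeasure M (space M) < \<infinity>)"
proof -
  have compact: "compact_embedding A B"
    if "finite_measure N" "sets N = sets M" "0 < C" "\<forall>E\<in>sets M. emeasure N E \<le> ennreal C * emeasure M E"
      "0 < q" "0 < r" "0 < \<beta>" "\<beta> < \<alpha>" "0 < p'" "p' < p"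
      "A = HTL_space d M \<alpha> p q \<or> A = HB_space d M \<alpha> p q"
      "B = HTL_space d N \<beta> p' r \<or> B = HB_space d N \<beta> p' r"
    for N :: "'a measure" and A B C \<alpha> p q r \<beta> p'
    using that by (intro controlled_embedding_compact[OF assms]) auto
  show ?thesis
  proof (intro conjI allI impI)
    assume "emeasure M (space M) < \<infinity>"
    then have "finite_measure M" by (intro finite_measureI) auto
    moreover have "\<forall>E\<in>sets M. emeasure M E \<le> ennreal 1 * emeasure M E" by simp
    note M = calculation refl[of "sets M"] zero_less_one[where 'a = real] this
    fix \<alpha> p \<beta> p' :: real and q r :: ennreal
    assume "0 < \<alpha> \<and> 0 < p \<and> 0 < q \<and> 0 < r \<and> 0 < \<beta> \<and> \<beta> < \<alpha> \<and> 0 < p' \<and> p' < p"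
    then have *: "0 < q" "0 < r" "0 < \<beta>" "\<beta> < \<alpha>" "0 < p'" "p' < p" by auto
    show "compact_embedding (HTL_space d M \<alpha> p q) (HTL_space d M \<beta> p' r)"
      "compact_embedding (HTL_space d M \<alpha> p q) (HB_space d M \<beta> p' r)"
      "compact_embedding (HB_space d M \<alpha> p q) (HTL_space d M \<beta> p' r)"
      "compact_embedding (HB_space d M \<alpha> p q) (HB_space d M \<beta> p' r)"
      by (rule compact[OF M *]; simp)+
  next
    assume "\<exists>(\<alpha>::real) (p::real) (q::ennreal) (r::ennreal) (\<beta>::real) (p'::real).
         0 < p \<and> 0 < \<beta> \<and> 0 < p' \<and> p' < p \<and> 0 < q \<and> 0 < r \<and>
         0 < \<alpha> \<and> below_index \<alpha> q (space M) d \<and>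
         (continuous_embedding (HTL_space d M \<alpha> p q) (HTL_space d M \<beta> p' r) \<or>
          continuous_embedding (HTL_space d M \<alpha> p q) (HB_space d M \<beta> p' r) \<or>
          continuous_embedding (HB_space d M \<alpha> p q) (HTL_space d M \<beta> p' r) \<or>
          continuous_embedding (HB_space d M \<alpha> p q) (HB_space d M \<beta> p' r))"
    then obtain \<alpha> p q r \<beta> p' where *: "0 < p'" "p' < p" "0 < q" "0 < \<alpha>" "below_index \<alpha> q (space M) d"
      "continuous_embedding (HTL_space d M \<alpha> p q) (HTL_space d M \<beta> p' r) \<or>
          continuous_embedding (HTL_space d M \<alpha> p q) (HB_space d M \<beta> p' r) \<or>
          continuous_embedding (HB_space d M \<alpha> p q) (HTL_space d M \<beta> p' r) \<or>
          continuous_embedding (HB_space d M \<alpha> p q) (HB_space d M \<beta> p' r)"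
      by blast
    show "emeasure M (space M) < \<infinity>"
      using *(6) embedding_implies_finite_measure[OF assms *(1-5)] by blast
  qed (use compact in blast)+
qed

end
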